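(* Let $\varepsilon=(\varepsilon_n)_{n\in\mathbf{Z}}$ be a coin-tossing sequence and, for each $n\in\mathbf{Z}$, let $H_n=h_n(\varepsilon_{n-1]})$ where $h_n:E\to\{-1,1\}$ is measurable and $E=\{-1,1\}^{-\mathbf{N}}$. Let $(N_n)_{n\in\mathbf{Z}}$ be the transition kernels on $E^2$ associated with $(h_n)_{n\in\mathbf{Z}}$ as defined in the context. The following are equivalent: (1) $\mathcal{F}_\infty^{H\varepsilon}=\mathcal{F}_\infty^{\varepsilon}$; (2) for every $n\in\mathbf{Z}$, $\mathcal{F}_n^{H\varepsilon}=\mathcal{F}_n^{\varepsilon}$; (3) every Markov chain $(X_n,Y_n)_{n\in\mathbf{Z}}$ on $E^2$ indexed by $\mathbf{Z}$ with transition kernels $(N_n)_{n\in\mathbf{Z}}$ almost surely lives on the diagonal of $E^2$ (i.e. almost surely $X_n=Y_n$ for all $n\in\mathbf{Z}$).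
   Context: $-\mathbf{N}=\{\dots,-2,-1,0\}$. A coin-tossing sequence is a family of independent random variables, each of law $(\delta_{-1}+\delta_1)/2$. For $x\in\{-1,1\}^{\mathbf{Z}}$ and $n\in\mathbf{Z}$, $x_{n]}=(x_{n+k})_{k\in-\mathbf{N}}$. For a process $\xi$, $\mathcal{F}_n^{\xi}=\sigma((\xi_k)_{k\le n})$, $\mathcal{F}_\infty^{\xi}=\sigma((\xi_k)_{k\in\mathbf{Z}})$; $H\varepsilon=(H_n\varepsilon_n)_{n\in\mathbf{Z}}$. All $\sigma$-fields are completed. For $n\in\mathbf{Z}$ and $\alpha\in\{-1,1\}$ (written also $-,+$), $f_\alpha^{(n)}:E\to E$ is defined by $f_\alpha^{(n)}((x_k)_{k\in-\mathbf{N}})=(y_k)_{k\in-\mathbf{N}}$ with $y_k=x_{k+1}$ for $k\le -1$ and $y_0=\alpha\,h_n((x_k)_{k\in-\mathbf{N}})$. The kernel $N_n$ on $E^2$ is $$N_n((a,b),\cdot)=\tfrac12\big(\delta_{(f_+^{(n)}(a),f_+^{(n)}(b))}+\delta_{(f_-^{(n)}(a),f_-^{(n)}(b))}\big).$$ A Markov chain $(X_n,Y_n)_{n\in\mathbf{Z}}$ with transition kernels $(N_n)_{n\in\mathbf{Z}}$ is a process (on some probability space) such that for each $n$ the conditional law of $(X_n,Y_n)$ given $(X_k,Y_k)_{k\le n-1}$ is $N_n((X_{n-1},Y_{n-1}),\cdot)$. *)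

theory Defs
  imports "HOL-Probability.Probability"
begin

abbreviation signs :: "int measure" where
  "signs \<equiv> count_space {-1, 1}"

text \<open>
  A point of \<open>{-1, 1}\<^bsup>-N\<^esup>\<close> is a function on the integers that takes values in \<open>{-1, 1}\<close> on \<open>{..0}\<close>
  and is \<^const>\<open>undefined\<close> on positive arguments.
\<close>

type_synonym sign_seq = "int \<Rightarrow> int"

definition E :: "sign_seq measure" where
  "E = PiM {..0} (\<lambda>_. signs)"

abbreviation E2 :: "(sign_seq \<times> sign_seq) measure" where
  "E2 \<equiv> E \<Otimes>\<^sub>M E"

definition coin_tossing :: "'a measure \<Rightarrow> (int \<Rightarrow> 'a \<Rightarrow> int) \<Rightarrow> bool" where
  "coin_tossing M \<epsilon> \<longleftrightarrow>
     prob_space.indep_vars M (\<lambda>_. signs) \<epsilon> UNIV \<and>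
     (\<forall>n. distr M signs (\<epsilon> n) = uniform_count_measure {-1, 1})"

definition past :: "(int \<Rightarrow> int) \<Rightarrow> int \<Rightarrow> sign_seq" where
  "past x n = (\<lambda>k\<in>{..0}. x (n + k))"

definition H_process ::
    "(int \<Rightarrow> sign_seq \<Rightarrow> int) \<Rightarrow> (int \<Rightarrow> 'a \<Rightarrow> int) \<Rightarrow> int \<Rightarrow> 'a \<Rightarrow> int" where
  "H_process h \<epsilon> n \<omega> = h n (past (\<lambda>k. \<epsilon> k \<omega>) (n - 1))"

definition generated_sigma ::
    "'a measure \<Rightarrow> 'b measure \<Rightarrow> (int \<Rightarrow> 'a \<Rightarrow> 'b) \<Rightarrow> int set \<Rightarrow> 'a measure" where
  "generated_sigma M S \<xi> I =
     sigma (space M) (\<Union>k\<in>I. {\<xi> k -` A \<inter> space M | A. A \<in> sets S})"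

text \<open>
  Completion adds every subset of an \<open>M\<close>-null set, not merely the subsets of those null sets
  that belong to the \<open>\<sigma>\<close>-field being completed.
\<close>

definition completed_sigma ::
    "'a measure \<Rightarrow> (int \<Rightarrow> 'a \<Rightarrow> int) \<Rightarrow> int set \<Rightarrow> 'a set set" where
  "completed_sigma M \<xi> I =
     sigma_sets (space M) (sets (generated_sigma M signs \<xi> I) \<union> null_sets (completion M))"

abbreviation F_at :: "'a measure \<Rightarrow> (int \<Rightarrow> 'a \<Rightarrow> int) \<Rightarrow> int \<Rightarrow> 'a set set" where
  "F_at M \<xi> n \<equiv> completed_sigma M \<xi> {..n}"

abbreviation F_infinity :: "'a measure \<Rightarrow> (int \<Rightarrow> 'a \<Rightarrow> int) \<Rightarrow> 'a set set" where
  "F_infinity M \<xi> \<equiv> completed_sigma M \<xi> UNIV"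

definition f_step :: "(int \<Rightarrow> sign_seq \<Rightarrow> int) \<Rightarrow> int \<Rightarrow> int \<Rightarrow> sign_seq \<Rightarrow> sign_seq" where
  "f_step h n \<alpha> x = (\<lambda>k\<in>{..0}. if k = 0 then \<alpha> * h n x else x (k + 1))"

definition pair_kernel ::
    "(int \<Rightarrow> sign_seq \<Rightarrow> int) \<Rightarrow> int \<Rightarrow> sign_seq \<times> sign_seq \<Rightarrow> (sign_seq \<times> sign_seq) measure" where
  "pair_kernel h n = (\<lambda>(a, b). measure_of (space E2) (sets E2) (\<lambda>A.
     (emeasure (return E2 (f_step h n 1 a, f_step h n 1 b)) A +
      emeasure (return E2 (f_step h n (-1) a, f_step h n (-1) b)) A) / 2))"

lemma sets_pair_kernel [simp]: "sets (pair_kernel h n p) = sets E2"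
  by (cases p) (simp add: pair_kernel_def sets.sigma_sets_eq sets.space_closed)

lemma emeasure_pair_kernel:
  assumes "A \<in> sets E2"
  shows "emeasure (pair_kernel h n (a, b)) A =
    (indicator A (f_step h n 1 a, f_step h n 1 b) +
     indicator A (f_step h n (-1) a, f_step h n (-1) b)) / 2"
proof -
  let ?\<mu> = "\<lambda>A. (emeasure (return E2 (f_step h n 1 a, f_step h n 1 b)) A +
      emeasure (return E2 (f_step h n (-1) a, f_step h n (-1) b)) A) / 2"
  have "emeasure (pair_kernel h n (a, b)) A = ?\<mu> A"
  proof (rule emeasure_measure_of[where M = "pair_kernel h n (a, b)" and \<mu> = ?\<mu>])
    show "pair_kernel h n (a, b) = measure_of (space E2) (sets E2) ?\<mu>"
      by (simp add: pair_kernel_def)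
    show "sets E2 \<subseteq> Pow (space E2)"
      by (rule sets.space_closed)
    show "positive (sets (pair_kernel h n (a, b))) ?\<mu>"
      by (simp add: positive_def)
    show "countably_additive (sets (pair_kernel h n (a, b))) ?\<mu>"
    proof (rule countably_additiveI)
      fix B :: "nat \<Rightarrow> (sign_seq \<times> sign_seq) set"
      assume B: "range B \<subseteq> sets (pair_kernel h n (a, b))" "disjoint_family B"
      have "(\<Sum>i. emeasure (return E2 q) (B i)) = emeasure (return E2 q) (\<Union>i. B i)" for q
        using B by (intro suminf_emeasure) auto
      moreover have "(\<Sum>i. ?\<mu> (B i)) =
          ((\<Sum>i. emeasure (return E2 (f_step h n 1 a, f_step h n 1 b)) (B i)) +
           (\<Sum>i. emeasure (return E2 (f_step h n (-1) a, f_step h n (-1) b)) (B i))) / 2"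
        by (simp add: divide_ennreal_def suminf_add)
      ultimately show "(\<Sum>i. ?\<mu> (B i)) = ?\<mu> (\<Union>i. B i)"
        by simp
    qed
  qed (use assms in simp)
  then show ?thesis
    using assms by simp
qed

definition markov_chain ::
    "(int \<Rightarrow> sign_seq \<Rightarrow> int) \<Rightarrow> 'b measure \<Rightarrow> (int \<Rightarrow> 'b \<Rightarrow> sign_seq) \<Rightarrow> (int \<Rightarrow> 'b \<Rightarrow> sign_seq) \<Rightarrow> bool"
where
  "markov_chain h P X Y \<longleftrightarrow>
     prob_space P \<and>
     (\<forall>n. X n \<in> P \<rightarrow>\<^sub>M E \<and> Y n \<in> P \<rightarrow>\<^sub>M E) \<and>
     (\<forall>n. \<forall>A \<in> sets E2. AE \<omega> in P.
        real_cond_exp P (generated_sigma P E2 (\<lambda>k \<omega>. (X k \<omega>, Y k \<omega>)) {..n - 1})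
          (\<lambda>\<omega>. indicator A (X n \<omega>, Y n \<omega>)) \<omega> =
        measure (pair_kernel h n (X (n - 1) \<omega>, Y (n - 1) \<omega>)) A)"

text \<open>\<^const>\<open>real_cond_exp\<close> is meaningful only for a sub-\<open>\<sigma>\<close>-field:\<close>

lemma subalgebra_generated_sigma:
  assumes "\<And>k. k \<in> I \<Longrightarrow> \<xi> k \<in> P \<rightarrow>\<^sub>M S"
  shows "subalgebra P (generated_sigma P S \<xi> I)"
proof -
  let ?G = "\<Union>k\<in>I. {\<xi> k -` A \<inter> space P | A. A \<in> sets S}"
  have "?G \<subseteq> sets P"
    using assms by (auto intro: measurable_sets)
  moreover have "?G \<subseteq> Pow (space P)"
    by blast
  ultimately show ?thesis
    by (simp add: subalgebra_def generated_sigma_def space_measure_of_conv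
        sigma_sets_le_sets_iff sets.sigma_sets_subset)
qed

text \<open>The type argument fixes the type of the sample spaces of the chains considered.\<close>

definition all_chains_diagonal :: "'b itself \<Rightarrow> (int \<Rightarrow> sign_seq \<Rightarrow> int) \<Rightarrow> bool" where
  "all_chains_diagonal (_ :: 'b itself) h \<longleftrightarrow>
     (\<forall>(P :: 'b measure) X Y. markov_chain h P X Y \<longrightarrow> (AE \<omega> in P. \<forall>n. X n \<omega> = Y n \<omega>))"

text \<open>
  HOL cannot quantify over types inside a formula. The path space of \<open>(X\<^sub>n, Y\<^sub>n)\<close> carries the law
  of every chain, so its type is large enough to stand for arbitrary sample spaces.
\<close>

type_synonym path = "int \<Rightarrow> sign_seq \<times> sign_seq"

end

theory Submission
  imports Defs
begin

text \<open>
  Write \<open>\<eta> = H\<epsilon>\<close>. Since \<open>H\<^sub>n\<close> is a function of \<open>\<epsilon>\<close> before time \<open>n\<close>, the sign \<open>\<eta>\<^sub>n\<close> is again fair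
  and independent of \<open>\<epsilon>\<close> before \<open>n\<close> (\<open>fair_\<eta>\<close>). The sequence \<open>\<eta>\<close> is the noise that drives \<open>\<epsilon>\<close>: the past
  of \<open>\<epsilon>\<close> at time \<open>n\<close> is \<open>f_step h n \<eta>\<^sub>n\<close> of the past at time \<open>n - 1\<close>. The question is whether
  this noise determines \<open>\<epsilon>\<close>, with no information entering at time \<open>-\<infinity>\<close>.

  The future of the noise is of no help. Given \<open>\<eta>\<close> before \<open>n\<close>, the signs \<open>\<eta>\<^sub>k\<close> with \<open>k \<ge> n\<close> are
  independent of \<open>\<epsilon>\<close> before \<open>n\<close>. Thus for an event \<open>B\<close> of \<open>\<epsilon>\<close> before \<open>n\<close>, conditioning on all of \<open>\<eta>\<close>
  and conditioning on \<open>\<eta>\<close> before \<open>n\<close> give the same result (\<open>nn_cond_exp_\<eta>_field\<close>). If \<open>\<eta>\<close> generates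
  the whole \<open>\<sigma>\<close>-field of \<open>\<epsilon>\<close>, the first conditional probability is the indicator of \<open>B\<close>, hence
  so is the second, and the \<open>\<sigma>\<close>-fields agree at every time.

  Suppose that \<open>\<eta>\<close> generates everything and let \<open>(X, Y)\<close> be a chain with the kernels of \<open>h\<close>. Both
  coordinate processes are then distributed as \<open>\<epsilon>\<close>, and they are driven by the same noise, so both
  are given by the same measurable function of that noise, and they coincide (\<open>chain_on_diagonal\<close>).
  This applies to chains on every probability space, so diagonality passes from chains on path space
  to all others.

  Conversely, take two copies of \<open>\<epsilon>\<close> that are conditionally independent given \<open>\<eta>\<close>. Their law is
  prescribed on rectangles by \<open>Q (A \<times> B) = \<integral> P(A | \<eta>) P(B | \<eta>)\<close>, which is \<open>\<integral>\<^sub>A P(B | \<eta>)\<close>, and it exists by the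
  Daniell-Kolmogorov theorem (\<open>coupling_exists\<close>). The copies share their noise, and the noise at
  time \<open>n\<close> is independent of the past of the pair, so the pair of pasts is a chain with the
  kernels of \<open>h\<close> (\<open>markov_chain_path_law\<close>). If that chain lives on the diagonal, then
  \<open>\<integral>\<^bsub>- B\<^esub> P(B | \<eta>) = 0\<close> for each event \<open>B\<close> of \<open>\<epsilon>\<close>, which forces \<open>B\<close> to be almost surely the
  event \<open>P(B | \<eta>) \<noteq> 0\<close> of \<open>\<eta>\<close> (\<open>F_infinity_eq_if_diagonal\<close>).
\<close>

section \<open>Generated and completed \<open>\<sigma>\<close>-fields\<close>

lemma space_generated_sigma [simp]: "space (generated_sigma M S \<xi> I) = space M"
  unfolding generated_sigma_def by (rule space_measure_of) auto

lemma measurable_generated_sigma: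
  assumes "k \<in> I" "\<xi> k \<in> space M \<rightarrow> space S"
  shows "\<xi> k \<in> generated_sigma M S \<xi> I \<rightarrow>\<^sub>M S"
proof -
  have gen: "(\<Union>k\<in>I. {\<xi> k -` A \<inter> space M | A. A \<in> sets S}) \<subseteq> Pow (space M)"
    by auto
  show ?thesis
  proof (rule measurableI)
    show "\<xi> k \<omega> \<in> space S" if "\<omega> \<in> space (generated_sigma M S \<xi> I)" for \<omega>
      using that assms by auto
    show "\<xi> k -` A \<inter> space (generated_sigma M S \<xi> I) \<in> sets (generated_sigma M S \<xi> I)"
      if "A \<in> sets S" for A
      unfolding space_generated_sigma unfolding generated_sigma_def sets_measure_of[OF gen]
      using that assms(1) by (intro sigma_sets.Basic) auto
  qed
qed

lemma sets_generated_sigma_subset: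
  assumes "space N = space M" "\<And>k. k \<in> I \<Longrightarrow> \<xi> k \<in> N \<rightarrow>\<^sub>M S"
  shows "sets (generated_sigma M S \<xi> I) \<subseteq> sets N"
proof -
  have gen: "(\<Union>k\<in>I. {\<xi> k -` A \<inter> space M | A. A \<in> sets S}) \<subseteq> Pow (space M)"
    by auto
  have "(\<Union>k\<in>I. {\<xi> k -` A \<inter> space M | A. A \<in> sets S}) \<subseteq> sets N"
    using measurable_sets[OF assms(2)] assms(1) by auto
  then show ?thesis
    unfolding generated_sigma_def sets_measure_of[OF gen]
    using sets.sigma_sets_subset[of _ N] assms(1) by simp
qed

text \<open>
  Every event of the generated \<open>\<sigma>\<close>-field is therefore the preimage of one measurable set under
  the whole process; this is how functions of the process are extracted from its events.
\<close>

lemma generated_sigma_eq_vimage_algebra: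
  assumes "\<And>k. k \<in> I \<Longrightarrow> \<xi> k \<in> space M \<rightarrow> space S"
  shows "sets (generated_sigma M S \<xi> I) =
    sets (vimage_algebra (space M) (\<lambda>\<omega>. \<lambda>k\<in>I. \<xi> k \<omega>) (PiM I (\<lambda>_. S)))" (is "_ = sets ?V")
proof
  have f: "(\<lambda>\<omega>. \<lambda>k\<in>I. \<xi> k \<omega>) \<in> space M \<rightarrow> space (PiM I (\<lambda>_. S))"
    using assms by (fastforce simp: space_PiM)
  show "sets (generated_sigma M S \<xi> I) \<subseteq> sets ?V"
  proof (rule sets_generated_sigma_subset)
    fix k assume "k \<in> I"
    then show "\<xi> k \<in> ?V \<rightarrow>\<^sub>M S"
      using measurable_compose[OF measurable_vimage_algebra1[OF f] measurable_component_singleton, of k]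
      by simp
  qed simp
  have "(\<lambda>\<omega>. \<lambda>k\<in>I. \<xi> k \<omega>) \<in> generated_sigma M S \<xi> I \<rightarrow>\<^sub>M PiM I (\<lambda>_. S)"
    using assms by (intro measurable_restrict measurable_generated_sigma)
  from measurable_sets[OF this] show "sets ?V \<subseteq> sets (generated_sigma M S \<xi> I)"
    by (auto simp: sets_vimage_algebra2[OF f])
qed

text \<open>
  The quantifier \<open>AE\<close> accepts non-measurable predicates, which makes it the right language for
  the completion.
\<close>

lemma null_sets_completion_iff_AE:
  "N \<in> null_sets (completion M) \<longleftrightarrow> N \<subseteq> space M \<and> (AE \<omega> in M. \<omega> \<notin> N)"
proof
  assume N: "N \<in> null_sets (completion M)"
  then obtain N' where "N' \<in> null_sets M" "N \<subseteq> N'"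
    unfolding null_sets_completion_iff2 by (elim bexE)
  then have "AE \<omega> in M. \<omega> \<notin> N"
    by (intro AE_I'[of N']) auto
  moreover have "N \<subseteq> space M"
    using sets.sets_into_space[of N "completion M"] null_setsD2[OF N] by simp
  ultimately show "N \<subseteq> space M \<and> (AE \<omega> in M. \<omega> \<notin> N)"
    by (intro conjI)
next
  assume "N \<subseteq> space M \<and> (AE \<omega> in M. \<omega> \<notin> N)"
  then have N: "N \<subseteq> space M" and "AE \<omega> in M. \<omega> \<notin> N" by auto
  then obtain N' where "N' \<in> null_sets M" "{\<omega>\<in>space M. \<not> \<omega> \<notin> N} \<subseteq> N'"
    unfolding eventually_ae_filter by auto
  with N show "N \<in> null_sets (completion M)"
    unfolding null_sets_completion_iff2 by (intro bexI[of _ N']) auto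
qed

text \<open>
  The sets that differ from an event of the \<open>\<sigma>\<close>-field only on a null set form a \<open>\<sigma>\<close>-algebra
  that contains the generators. In what follows completions enter only through this criterion.
\<close>

lemma mem_completed_sigma_iff:
  "B \<in> completed_sigma M \<xi> I \<longleftrightarrow>
    B \<subseteq> space M \<and> (\<exists>C \<in> sets (generated_sigma M signs \<xi> I). AE \<omega> in M. \<omega> \<in> B \<longleftrightarrow> \<omega> \<in> C)"
    (is "_ \<longleftrightarrow> ?R B")
proof
  let ?G = "generated_sigma M signs \<xi> I"
  let ?g = "sets ?G \<union> null_sets (completion M)"
  assume "B \<in> completed_sigma M \<xi> I"
  then have "B \<in> sigma_sets (space M) ?g"
    by (simp add: completed_sigma_def)
  then show "?R B"
  proof (induction rule: sigma_sets.induct)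
    case (Basic a)
    show ?case
    proof (cases "a \<in> sets ?G")
      case True
      then show ?thesis using sets.sets_into_space[OF True] by auto
    next
      case False
      then have "a \<subseteq> space M" "AE \<omega> in M. \<omega> \<notin> a"
        using Basic null_sets_completion_iff_AE[of a M] by simp_all
      then show ?thesis by (intro conjI bexI[of _ "{}"]) auto
    qed
  next
    case Empty
    show ?case by (intro conjI bexI[of _ "{}"]) auto
  next
    case (Compl a)
    then obtain C where C: "C \<in> sets ?G" "AE \<omega> in M. \<omega> \<in> a \<longleftrightarrow> \<omega> \<in> C"
      by blast
    have "space M - C \<in> sets ?G"
      using sets.compl_sets[OF C(1)] by simp
    moreover have "AE \<omega> in M. \<omega> \<in> space M - a \<longleftrightarrow> \<omega> \<in> space M - C"
      using C(2) by eventually_elim auto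
    ultimately show ?case by blast
  next
    case (Union a)
    then have "\<forall>i. \<exists>C. C \<in> sets ?G \<and> (AE \<omega> in M. \<omega> \<in> a i \<longleftrightarrow> \<omega> \<in> C)" by blast
    then obtain C where C: "\<And>i. C i \<in> sets ?G" "\<And>i. AE \<omega> in M. \<omega> \<in> a i \<longleftrightarrow> \<omega> \<in> C i"
      by metis
    have "AE \<omega> in M. \<forall>i. \<omega> \<in> a i \<longleftrightarrow> \<omega> \<in> C i"
      using C(2) by (simp add: AE_all_countable)
    then have "AE \<omega> in M. \<omega> \<in> (\<Union>i. a i) \<longleftrightarrow> \<omega> \<in> (\<Union>i. C i)"
      by eventually_elim simp
    moreover have "(\<Union>i. C i) \<in> sets ?G" using C(1) by blast
    moreover have "(\<Union>i. a i) \<subseteq> space M" using Union.IH by blast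
    ultimately show ?case by blast
  qed
next
  let ?G = "generated_sigma M signs \<xi> I"
  let ?g = "sets ?G \<union> null_sets (completion M)"
  have sub: "?g \<subseteq> Pow (space M)"
    using sets.space_closed[of ?G] sets.space_closed[of "completion M"] by (auto simp: null_sets_def)
  interpret sigma_algebra "space M" "sigma_sets (space M) ?g"
    by (rule sigma_algebra_sigma_sets[OF sub])
  assume "?R B"
  then obtain C where B: "B \<subseteq> space M" and C: "C \<in> sets ?G" "AE \<omega> in M. \<omega> \<in> B \<longleftrightarrow> \<omega> \<in> C"
    by blast
  have CM: "C \<subseteq> space M" using sets.sets_into_space[OF C(1)] by simp
  have "AE \<omega> in M. \<omega> \<notin> C - B" "AE \<omega> in M. \<omega> \<notin> B - C"
    using C(2) by (eventually_elim, simp)+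
  then have "C - B \<in> null_sets (completion M)" "B - C \<in> null_sets (completion M)"
    using B CM unfolding null_sets_completion_iff_AE by blast+
  then have "C \<in> sigma_sets (space M) ?g" "C - B \<in> sigma_sets (space M) ?g"
      "B - C \<in> sigma_sets (space M) ?g"
    using C(1) by (blast intro: sigma_sets.Basic)+
  then have "(C - (C - B)) \<union> (B - C) \<in> sigma_sets (space M) ?g"
    by (blast intro: Un Diff)
  also have "(C - (C - B)) \<union> (B - C) = B" by blast
  finally show "B \<in> completed_sigma M \<xi> I"
    by (simp add: completed_sigma_def)
qed

lemma completed_sigma_subset:
  assumes "\<And>k A. k \<in> I \<Longrightarrow> A \<subseteq> {-1, 1} \<Longrightarrow> \<xi> k -` A \<inter> space M \<in> completed_sigma M \<zeta> J"
  shows "completed_sigma M \<xi> I \<subseteq> completed_sigma M \<zeta> J"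
proof -
  let ?g = "\<lambda>\<xi> I. sets (generated_sigma M signs \<xi> I) \<union> null_sets (completion M)"
  have sub: "?g \<zeta> J \<subseteq> Pow (space M)" for \<zeta> J
    using sets.space_closed[of "generated_sigma M signs \<zeta> J"] sets.space_closed[of "completion M"]
    by (auto simp: null_sets_def)
  interpret C: sigma_algebra "space M" "completed_sigma M \<zeta> J"
    unfolding completed_sigma_def by (rule sigma_algebra_sigma_sets[OF sub])
  have gen: "(\<Union>k\<in>I. {\<xi> k -` A \<inter> space M | A. A \<in> sets signs}) \<subseteq> Pow (space M)"
    by auto
  have "sets (generated_sigma M signs \<xi> I) \<subseteq> completed_sigma M \<zeta> J"
    unfolding generated_sigma_def sets_measure_of[OF gen]
    using assms by (intro C.sigma_sets_subset) auto
  moreover have "null_sets (completion M) \<subseteq> completed_sigma M \<zeta> J"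
    unfolding completed_sigma_def by (auto intro: sigma_sets.Basic)
  ultimately have "?g \<xi> I \<subseteq> completed_sigma M \<zeta> J" by auto
  then show ?thesis
    unfolding completed_sigma_def[of M \<xi> I] by (rule C.sigma_sets_subset)
qed

lemma measurable_into_generated_sigma:
  assumes "f \<in> space N \<rightarrow> space M" "\<And>k. k \<in> I \<Longrightarrow> (\<lambda>\<omega>. \<xi> k (f \<omega>)) \<in> N \<rightarrow>\<^sub>M S"
  shows "f \<in> N \<rightarrow>\<^sub>M generated_sigma M S \<xi> I"
  unfolding generated_sigma_def
proof (rule measurable_measure_of)
  fix Y assume "Y \<in> (\<Union>k\<in>I. {\<xi> k -` A \<inter> space M | A. A \<in> sets S})"
  then obtain k A where kA: "k \<in> I" "A \<in> sets S" "Y = \<xi> k -` A \<inter> space M" by auto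
  then have "f -` Y \<inter> space N = (\<lambda>\<omega>. \<xi> k (f \<omega>)) -` A \<inter> space N"
    using assms(1) by auto
  then show "f -` Y \<inter> space N \<in> sets N"
    using measurable_sets[OF assms(2)] kA by simp
qed (use assms(1) in auto)

section \<open>Fair signs\<close>

abbreviation sign_sequences :: "(int \<Rightarrow> int) measure" where
  "sign_sequences \<equiv> PiM UNIV (\<lambda>_. signs)"

text \<open>
  A fair sign independent of \<open>F\<close>. Scaling by one half, in place of a product formula, extends from
  events of \<open>F\<close> to integrals of \<open>F\<close>-measurable functions.
\<close>

definition fair_given :: "'a measure \<Rightarrow> 'a measure \<Rightarrow> ('a \<Rightarrow> int) \<Rightarrow> bool" where
  "fair_given M F X \<longleftrightarrow> subalgebra M F \<and> X \<in> M \<rightarrow>\<^sub>M signs \<and>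
    (\<forall>B\<in>sets F. \<forall>s\<in>{-1, 1}. emeasure M (B \<inter> X -` {s}) = emeasure M B / 2)"

lemma measurable_signs_iff:
  "X \<in> M \<rightarrow>\<^sub>M signs \<longleftrightarrow> X \<in> space M \<rightarrow> {-1, 1} \<and> (\<forall>s\<in>{-1, 1}. X -` {s} \<inter> space M \<in> sets M)"
  by (subst measurable_count_space_eq2) auto

lemma measurable_signs_mult:
  assumes "X \<in> M \<rightarrow>\<^sub>M signs" "Y \<in> M \<rightarrow>\<^sub>M signs"
  shows "(\<lambda>\<omega>. X \<omega> * Y \<omega>) \<in> M \<rightarrow>\<^sub>M signs"
proof -
  have "(\<lambda>\<omega>. (X \<omega>, Y \<omega>)) \<in> M \<rightarrow>\<^sub>M count_space ({-1, 1} \<times> {-1, 1})"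
    using measurable_Pair[OF assms] by (simp add: pair_measure_countable)
  from measurable_compose[OF this, of "\<lambda>(x, y). x * y" signs] show ?thesis
    by simp
qed

lemma borel_measurable_signs_indicator:
  assumes "X \<in> N \<rightarrow>\<^sub>M signs"
  shows "(\<lambda>\<omega>. indicator S (X \<omega>) :: ennreal) \<in> borel_measurable N"
  by (rule measurable_compose[OF assms]) simp

lemma emeasure_uniform_signs:
  "S \<subseteq> {-1, 1} \<Longrightarrow> emeasure (uniform_count_measure {-1, 1::int}) S = of_nat (card S) / 2"
  using divide_ennreal[of "real (card S)" 2]
  by (simp add: emeasure_uniform_count_measure ennreal_of_nat_eq_real_of_nat)

lemma ennreal_double_half: "2 * (x / 2) = (x :: ennreal)"
  using mult_divide_eq_ennreal[of 2 x] by (simp add: ennreal_times_divide mult.commute)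

lemma prod_indicator_ennreal:
  "finite J \<Longrightarrow> (\<Prod>j\<in>J. indicator (A j) (x j) :: ennreal) = indicator {x. \<forall>j\<in>J. x j \<in> A j} x"
  by (induction J rule: finite_induct) (auto simp: indicator_def)

lemma measurable_sequence:
  assumes "\<And>k. \<xi> k \<in> N \<rightarrow>\<^sub>M S"
  shows "(\<lambda>\<omega> k. \<xi> k \<omega>) \<in> N \<rightarrow>\<^sub>M PiM UNIV (\<lambda>_. S)"
  using measurable_restrict[of UNIV \<xi> N "\<lambda>_. S"] assms by (simp add: restrict_def)

lemma measurable_finer:
  assumes "f \<in> N \<rightarrow>\<^sub>M K" "space N' = space N" "sets N \<subseteq> sets N'"
  shows "f \<in> N' \<rightarrow>\<^sub>M K"
  using assms by (auto simp: measurable_def)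

text \<open>
  Under the density \<open>2 * indicator {s} (X \<omega>)\<close> the measure of every event of \<open>F\<close> is unchanged, so
  integrals of \<open>F\<close>-measurable functions are unchanged as well.
\<close>

lemma fair_given_nn_integral_singleton:
  assumes X: "fair_given M F X" and s: "s \<in> {-1, 1}" and f: "f \<in> borel_measurable F"
  shows "(\<integral>\<^sup>+\<omega>. f \<omega> * indicator {s} (X \<omega>) \<partial>M) = (\<integral>\<^sup>+\<omega>. f \<omega> \<partial>M) / 2"
proof -
  have sub: "subalgebra M F" and [measurable]: "X \<in> M \<rightarrow>\<^sub>M signs"
    and half: "\<And>B. B \<in> sets F \<Longrightarrow> emeasure M (B \<inter> X -` {s}) = emeasure M B / 2"
    using X s by (auto simp: fair_given_def)
  have id: "(\<lambda>x. x) \<in> M \<rightarrow>\<^sub>M F"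
    using sub by (auto simp: subalgebra_def intro!: measurableI)
  let ?N = "density M (\<lambda>\<omega>. 2 * indicator {s} (X \<omega>))"
  have [measurable]: "(\<lambda>\<omega>. indicator {s} (X \<omega>) :: ennreal) \<in> borel_measurable M"
    by (rule borel_measurable_signs_indicator) fact
  have fM [measurable]: "f \<in> borel_measurable M"
    by (rule measurable_from_subalg[OF sub f])
  have "distr ?N F (\<lambda>x. x) = distr M F (\<lambda>x. x)"
  proof (rule measure_eqI)
    fix B assume "B \<in> sets (distr ?N F (\<lambda>x. x))"
    then have B: "B \<in> sets F" by simp
    then have BM [measurable]: "B \<in> sets M" using sub by (auto simp: subalgebra_def)
    have "X -` {s} \<inter> space M \<in> sets M"
      using s by (intro measurable_sets[of X M signs]) auto
    then have *: "B \<inter> X -` {s} \<in> sets M"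
      using sets.Int[OF BM, of "X -` {s} \<inter> space M"] sets.sets_into_space[OF BM]
      by (metis Int_absorb2 inf_assoc inf_commute)
    have "emeasure ?N B = (\<integral>\<^sup>+\<omega>. 2 * indicator (B \<inter> X -` {s}) \<omega> \<partial>M)"
      by (subst emeasure_density) (auto intro!: nn_integral_cong split: split_indicator)
    also have "\<dots> = 2 * emeasure M (B \<inter> X -` {s})"
      using * by (simp add: nn_integral_cmult)
    also have "\<dots> = emeasure M B"
      by (simp add: half[OF B] ennreal_double_half)
    finally show "emeasure (distr ?N F (\<lambda>x. x)) B = emeasure (distr M F (\<lambda>x. x)) B"
      using B id sets.sets_into_space[OF BM]
      by (simp add: emeasure_distr Int_absorb2)
  qed simp
  then have "(\<integral>\<^sup>+\<omega>. f \<omega> \<partial>distr ?N F (\<lambda>x. x)) = (\<integral>\<^sup>+\<omega>. f \<omega> \<partial>distr M F (\<lambda>x. x))"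
    by simp
  then have "(\<integral>\<^sup>+\<omega>. f \<omega> \<partial>M) = (\<integral>\<^sup>+\<omega>. 2 * indicator {s} (X \<omega>) * f \<omega> \<partial>M)"
    using f id by (simp add: nn_integral_distr nn_integral_density)
  also have "\<dots> = 2 * (\<integral>\<^sup>+\<omega>. f \<omega> * indicator {s} (X \<omega>) \<partial>M)"
    by (subst nn_integral_cmult[symmetric]) (auto simp: ac_simps)
  finally show ?thesis
    by (metis ennreal_times_divide ennreal_double_half)
qed

lemma fair_given_nn_integral:
  assumes X: "fair_given M F X" and S: "S \<subseteq> {-1, 1}" and f: "f \<in> borel_measurable F"
  shows "(\<integral>\<^sup>+\<omega>. f \<omega> * indicator S (X \<omega>) \<partial>M) =
    emeasure (uniform_count_measure {-1, 1}) S * (\<integral>\<^sup>+\<omega>. f \<omega> \<partial>M)"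
proof -
  have sub: "subalgebra M F" and XM: "X \<in> M \<rightarrow>\<^sub>M signs"
    using X by (auto simp: fair_given_def)
  have fin: "finite S" using S by (rule finite_subset) simp
  have "(\<integral>\<^sup>+\<omega>. f \<omega> * indicator S (X \<omega>) \<partial>M) = (\<integral>\<^sup>+\<omega>. (\<Sum>s\<in>S. f \<omega> * indicator {s} (X \<omega>)) \<partial>M)"
    using fin by (intro nn_integral_cong) (auto simp: indicator_def simp flip: sum_distrib_left)
  also have "\<dots> = (\<Sum>s\<in>S. \<integral>\<^sup>+\<omega>. f \<omega> * indicator {s} (X \<omega>) \<partial>M)"
    using measurable_from_subalg[OF sub f] borel_measurable_signs_indicator[OF XM]
    by (intro nn_integral_sum) auto
  also have "\<dots> = (\<Sum>s\<in>S. (\<integral>\<^sup>+\<omega>. f \<omega> \<partial>M) / 2)"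
    using S by (intro sum.cong fair_given_nn_integral_singleton[OF X _ f]) auto
  finally show ?thesis
    by (simp add: emeasure_uniform_signs[OF S] divide_ennreal_def ac_simps)
qed

text \<open>
  Conditionally on \<open>F\<close> the factor \<open>H\<close> is a constant sign, and the uniform law on the two signs
  is invariant under a change of sign.
\<close>

lemma fair_given_mult:
  assumes X: "fair_given M F X" and H: "H \<in> F \<rightarrow>\<^sub>M signs"
  shows "fair_given M F (\<lambda>\<omega>. H \<omega> * X \<omega>)"
  unfolding fair_given_def
proof (intro conjI ballI)
  have sub: "subalgebra M F" and XM: "X \<in> M \<rightarrow>\<^sub>M signs"
    using X by (auto simp: fair_given_def)
  have HM: "H \<in> M \<rightarrow>\<^sub>M signs" by (rule measurable_from_subalg[OF sub H])
  show "subalgebra M F" by fact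
  show "(\<lambda>\<omega>. H \<omega> * X \<omega>) \<in> M \<rightarrow>\<^sub>M signs"
    by (rule measurable_signs_mult[OF HM XM])
  fix B and s :: int assume B: "B \<in> sets F" and s: "s \<in> {-1, 1}"
  define C where "C t = B \<inter> (H -` {t} \<inter> space F)" for t
  have C: "C t \<in> sets F" if "t \<in> {-1, 1}" for t
    using H B that unfolding C_def measurable_signs_iff by auto
  have CM: "C t \<in> sets M" if "t \<in> {-1, 1}" for t
    using C[OF that] sub by (auto simp: subalgebra_def)
  have CX: "C t \<inter> X -` {u} \<in> sets M" if "t \<in> {-1, 1}" "u \<in> {-1, 1}" for t u
  proof -
    have "C t \<inter> X -` {u} = C t \<inter> (X -` {u} \<inter> space M)"
      using sets.sets_into_space[OF CM[OF that(1)]] by auto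
    then show ?thesis
      using CM[OF that(1)] XM that(2) unfolding measurable_signs_iff by auto
  qed
  have B_space: "\<omega> \<in> space F" if "\<omega> \<in> B" for \<omega>
    using sets.sets_into_space[OF B] that by auto
  have Hv: "H \<omega> = 1 \<or> H \<omega> = -1" if "\<omega> \<in> B" for \<omega>
    using measurable_space[OF H B_space[OF that]] by auto
  have B_eq: "B = C 1 \<union> C (-1)" and B_int: "B \<inter> (\<lambda>\<omega>. H \<omega> * X \<omega>) -` {s} = (C 1 \<inter> X -` {s}) \<union> (C (-1) \<inter> X -` {- s})"
    using Hv by (force simp: C_def B_space)+
  have disj: "C 1 \<inter> C (-1) = {}" by (auto simp: C_def)
  have "emeasure M (B \<inter> (\<lambda>\<omega>. H \<omega> * X \<omega>) -` {s}) =
      emeasure M (C 1 \<inter> X -` {s}) + emeasure M (C (-1) \<inter> X -` {- s})"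
    unfolding B_int using CX[of 1 s] CX[of "-1" "-s"] s disj by (intro plus_emeasure[symmetric]) auto
  also have "\<dots> = emeasure M (C 1) / 2 + emeasure M (C (-1)) / 2"
    using X C s by (auto simp: fair_given_def)
  also have "\<dots> = emeasure M B / 2"
    unfolding B_eq using plus_emeasure[OF CM[of 1] CM[of "-1"] disj]
    by (simp add: divide_ennreal_def flip: distrib_right)
  finally show "emeasure M (B \<inter> (\<lambda>\<omega>. H \<omega> * X \<omega>) -` {s}) = emeasure M B / 2" .
qed

text \<open>
  From time \<open>n\<close> on, an adapted sequence of signs that are fair given the past is independent of the
  past at time \<open>n\<close>. The induction removes the latest index first, because all the other
  factors are known when that sign is tossed.
\<close>

lemma nn_integral_fair_cylinder:
  fixes \<xi> :: "int \<Rightarrow> 'a \<Rightarrow> int"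
  assumes fair: "\<And>k. n \<le> k \<Longrightarrow> fair_given M (F k) (\<xi> k)"
    and adapted: "\<And>j k. n \<le> j \<Longrightarrow> j < k \<Longrightarrow> \<xi> j \<in> F k \<rightarrow>\<^sub>M signs"
    and mono: "\<And>k. n \<le> k \<Longrightarrow> sets (F n) \<subseteq> sets (F k)"
    and f: "f \<in> borel_measurable (F n)"
    and "finite J" "J \<subseteq> {n..}" "\<And>j. j \<in> J \<Longrightarrow> A j \<subseteq> {-1, 1}"
  shows "(\<integral>\<^sup>+\<omega>. f \<omega> * (\<Prod>j\<in>J. indicator (A j) (\<xi> j \<omega>)) \<partial>M) =
    (\<Prod>j\<in>J. emeasure (uniform_count_measure {-1, 1}) (A j)) * (\<integral>\<^sup>+\<omega>. f \<omega> \<partial>M)"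
  using assms(5-)
proof (induction J rule: finite_linorder_max_induct)
  case empty
  then show ?case by simp
next
  case (insert b J)
  have b: "n \<le> b" "b \<notin> J" and J: "J \<subseteq> {n..}" using insert by auto
  have space_F: "space (F k) = space M" if "n \<le> k" for k
    using fair[OF that] by (simp add: fair_given_def subalgebra_def)
  have fb: "f \<in> borel_measurable (F b)"
    using space_F b by (intro measurable_finer[OF f _ mono]) auto
  have "(\<lambda>\<omega>. f \<omega> * (\<Prod>j\<in>J. indicator (A j) (\<xi> j \<omega>))) \<in> borel_measurable (F b)"
    using fb insert.hyps(2) J
    by (intro borel_measurable_times_ennreal borel_measurable_prod_ennreal borel_measurable_signs_indicator adapted) auto
  from fair_given_nn_integral[OF fair[OF b(1)] _ this, of "A b"] show ?case
    using insert b by (simp add: ac_simps)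
qed

text \<open>
  The law of such a sequence does not depend on the filtration or on the probability space; this
  allows the law of one coordinate of a chain to be compared with the law of \<open>\<epsilon>\<close>.
\<close>

lemma distr_fair_sequence:
  fixes \<xi> :: "int \<Rightarrow> 'a \<Rightarrow> int"
  assumes "prob_space M"
    and fair: "\<And>k. fair_given M (F k) (\<xi> k)"
    and adapted: "\<And>j k. j < k \<Longrightarrow> \<xi> j \<in> F k \<rightarrow>\<^sub>M signs"
    and mono: "\<And>j k. j \<le> k \<Longrightarrow> sets (F j) \<subseteq> sets (F k)"
  shows "distr M (PiM UNIV (\<lambda>_. signs)) (\<lambda>\<omega> k. \<xi> k \<omega>) =
    PiM UNIV (\<lambda>_. uniform_count_measure {-1, 1})"
proof (rule measure_eqI_PiM_infinite[where M = "\<lambda>_. signs"])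
  interpret prob_space M by fact
  have rv: "\<xi> k \<in> M \<rightarrow>\<^sub>M signs" for k using fair by (simp add: fair_given_def)
  have V: "(\<lambda>\<omega> k. \<xi> k \<omega>) \<in> M \<rightarrow>\<^sub>M PiM UNIV (\<lambda>_. signs)"
    using rv by (rule measurable_sequence)
  show "sets (PiM UNIV (\<lambda>_. uniform_count_measure {-1, 1})) = sets (PiM UNIV (\<lambda>_. signs))"
    by (intro sets_PiM_cong) (auto simp: sets_uniform_count_measure)
  show "finite_measure (distr M (PiM UNIV (\<lambda>_. signs)) (\<lambda>\<omega> k. \<xi> k \<omega>))"
    using prob_space_distr[OF V] by (rule prob_space.finite_measure)
  fix A :: "int \<Rightarrow> int set" and J :: "int set"
  assume J: "finite J" "J \<subseteq> UNIV" and "\<And>i. i \<in> J \<Longrightarrow> A i \<in> sets signs"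
  then have A: "\<And>i. i \<in> J \<Longrightarrow> A i \<subseteq> {-1, 1}" by auto
  \<comment> \<open>The time axis has no first point, but a finite set of times does.\<close>
  obtain n where n: "J \<subseteq> {n..}"
    using J(1) by (meson atLeast_iff bdd_below.unfold bdd_below_finite subsetI)
  have "emeasure (distr M (PiM UNIV (\<lambda>_. signs)) (\<lambda>\<omega> k. \<xi> k \<omega>)) (prod_emb UNIV (\<lambda>_. signs) J (Pi\<^sub>E J A))
      = (\<integral>\<^sup>+\<omega>. 1 * (\<Prod>j\<in>J. indicator (A j) (\<xi> j \<omega>)) \<partial>M)"
  proof -
    have eq: "(\<lambda>\<omega> k. \<xi> k \<omega>) -` prod_emb UNIV (\<lambda>_. signs) J (Pi\<^sub>E J A) \<inter> space M = {\<omega>\<in>space M. \<forall>j\<in>J. \<xi> j \<omega> \<in> A j}"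
      using measurable_space[OF rv] by (auto simp: prod_emb_def PiE_iff extensional_def restrict_def)
    have X: "prod_emb UNIV (\<lambda>_. signs) J (Pi\<^sub>E J A) \<in> sets (PiM UNIV (\<lambda>_. signs))"
      using J A by (intro sets_PiM_I) auto
    have "{\<omega>\<in>space M. \<forall>j\<in>J. \<xi> j \<omega> \<in> A j} \<in> sets M"
      using measurable_sets[OF V X] unfolding eq .
    then have "emeasure M {\<omega>\<in>space M. \<forall>j\<in>J. \<xi> j \<omega> \<in> A j} = (\<integral>\<^sup>+\<omega>. 1 * (\<Prod>j\<in>J. indicator (A j) (\<xi> j \<omega>)) \<partial>M)"
      unfolding prod_indicator_ennreal[OF J(1)]
      by (subst nn_integral_indicator[symmetric], assumption, intro nn_integral_cong)
        (simp split: split_indicator)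
    then show ?thesis
      unfolding emeasure_distr[OF V X] eq .
  qed
  also have "\<dots> = (\<Prod>j\<in>J. emeasure (uniform_count_measure {-1, 1}) (A j))"
    using nn_integral_fair_cylinder[of n M F \<xi> "\<lambda>_. 1" J A] fair adapted mono J n A
    by (simp add: emeasure_space_1)
  also have "\<dots> = emeasure (PiM UNIV (\<lambda>_. uniform_count_measure {-1, 1})) (prod_emb UNIV (\<lambda>_. signs) J (Pi\<^sub>E J A))"
  proof -
    have "prod_emb UNIV (\<lambda>_. uniform_count_measure {-1, 1::int}) J (Pi\<^sub>E J A) = prod_emb UNIV (\<lambda>_. signs) J (Pi\<^sub>E J A)"
      by (simp add: prod_emb_def space_uniform_count_measure)
    then show ?thesis
      using emeasure_PiM_emb[of UNIV "\<lambda>_. uniform_count_measure {-1, 1::int}" J A] J A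
      by (simp add: prob_space_uniform_count_measure sets_uniform_count_measure)
  qed
  finally show "emeasure (distr M (PiM UNIV (\<lambda>_. signs)) (\<lambda>\<omega> k. \<xi> k \<omega>)) (prod_emb UNIV (\<lambda>_. signs) J (Pi\<^sub>E J A))
    = emeasure (PiM UNIV (\<lambda>_. uniform_count_measure {-1, 1})) (prod_emb UNIV (\<lambda>_. signs) J (Pi\<^sub>E J A))" .
qed simp

text \<open>
  Fairness need only be checked on an intersection-stable generator, by Dynkin's argument.
\<close>

lemma (in prob_space) fair_givenI_generator:
  assumes sub: "subalgebra M F" and X: "X \<in> M \<rightarrow>\<^sub>M signs"
    and F: "sets F = sigma_sets (space M) G" and G: "Int_stable G" "G \<subseteq> Pow (space M)" "space M \<in> G"
    and half: "\<And>B s. B \<in> G \<Longrightarrow> s \<in> {-1, 1} \<Longrightarrow> emeasure M (B \<inter> X -` {s}) = emeasure M B / 2"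
  shows "fair_given M F X"
  unfolding fair_given_def
proof (intro conjI ballI)
  fix B and s :: int assume B: "B \<in> sets F" and s: "s \<in> {-1, 1}"
  let ?Z = "X -` {s} \<inter> space M"
  have Z: "?Z \<in> sets M" using s by (intro measurable_sets[OF X]) auto
  have F_M: "D \<in> sets M" if "D \<in> sigma_sets (space M) G" for D
    using that sub F by (auto simp: subalgebra_def)
  have BZ: "D \<inter> X -` {s} = D \<inter> ?Z" if "D \<subseteq> space M" for D
    using that by auto
  have rect: "prob (D \<inter> ?Z) = prob D / 2" if "D \<in> G" for D
    using half[OF that s] BZ[of D] G(2) that divide_ennreal[of "prob D" 2]
    by (auto simp: emeasure_eq_measure)
  have "B \<in> sigma_sets (space M) G" using B F by simp
  with G(1,2) have "prob (B \<inter> ?Z) = prob B / 2"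
  proof (induction rule: sigma_sets_induct_disjoint)
    case (basic D)
    then show ?case by (rule rect)
  next
    case empty
    show ?case by simp
  next
    case (compl D)
    note D = F_M[OF compl.hyps]
    have "prob ((space M - D) \<inter> ?Z) = prob (space M \<inter> ?Z) - prob (D \<inter> ?Z)"
    proof -
      have "(space M - D) \<inter> ?Z = (space M \<inter> ?Z) - (D \<inter> ?Z)" by blast
      then show ?thesis
        using finite_measure_Diff[of "space M \<inter> ?Z" "D \<inter> ?Z"] D Z sets.sets_into_space[OF D] by auto
    qed
    then show ?case
      unfolding compl.IH rect[OF G(3)] using prob_compl[OF D] by (simp add: prob_space field_simps)
  next
    case (union D)
    have D: "range D \<subseteq> sets M" using union.hyps F_M by blast
    have "(\<lambda>i. prob (D i \<inter> ?Z)) sums prob (\<Union>i. D i \<inter> ?Z)"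
    proof (rule finite_measure_UNION)
      show "range (\<lambda>i. D i \<inter> ?Z) \<subseteq> sets M" using D Z by blast
      show "disjoint_family (\<lambda>i. D i \<inter> ?Z)"
        using union.hyps(1) by (rule disjoint_family_subset) blast
    qed
    moreover have "(\<lambda>i. prob (D i \<inter> ?Z)) sums (prob (\<Union>i. D i) / 2)"
      unfolding union.IH using D union.hyps(1) by (intro sums_divide finite_measure_UNION)
    ultimately have limit: "prob (\<Union>i. D i \<inter> ?Z) = prob (\<Union>i. D i) / 2"
      by (rule sums_unique2)
    have "(\<Union>i. D i) \<inter> ?Z = (\<Union>i. D i \<inter> ?Z)" by blast
    then show ?case unfolding limit[symmetric] by (rule arg_cong)
  qed
  moreover have "B \<subseteq> space M"
    using sets.sets_into_space[OF B] sub by (simp add: subalgebra_def)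
  ultimately show "emeasure M (B \<inter> X -` {s}) = emeasure M B / 2"
    using BZ divide_ennreal[of "prob B" 2] by (simp add: emeasure_eq_measure)
qed (use sub X in auto)

section \<open>The sign change of a coin-tossing sequence\<close>

lemma measurable_past:
  assumes "\<And>k. k \<le> n \<Longrightarrow> \<xi> k \<in> N \<rightarrow>\<^sub>M signs"
  shows "(\<lambda>\<omega>. past (\<lambda>k. \<xi> k \<omega>) n) \<in> N \<rightarrow>\<^sub>M E"
  unfolding past_def E_def using assms by (intro measurable_restrict) auto

lemma vimage_mem_completed_sigma:
  assumes "\<xi> k \<in> generated_sigma M signs \<zeta> J \<rightarrow>\<^sub>M signs" "A \<subseteq> {-1, 1}"
  shows "\<xi> k -` A \<inter> space M \<in> completed_sigma M \<zeta> J"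
  unfolding mem_completed_sigma_iff
  using measurable_sets[OF assms(1), of A] assms(2) by (intro conjI bexI) auto

text \<open>
  The letter \<open>\<eta>\<close> stands for \<open>H\<epsilon>\<close>. The \<open>\<sigma>\<close>-fields named below are not completed; null sets are
  treated through \<open>mem_completed_sigma_iff\<close>.
\<close>

locale sign_change = prob_space M for M :: "'a measure" +
  fixes \<epsilon> :: "int \<Rightarrow> 'a \<Rightarrow> int" and h :: "int \<Rightarrow> sign_seq \<Rightarrow> int"
  assumes coin: "coin_tossing M \<epsilon>" and h_measurable: "\<And>n. h n \<in> E \<rightarrow>\<^sub>M signs"
begin

abbreviation \<eta> :: "int \<Rightarrow> 'a \<Rightarrow> int" where
  "\<eta> \<equiv> \<lambda>n \<omega>. H_process h \<epsilon> n \<omega> * \<epsilon> n \<omega>"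

abbreviation \<epsilon>_before :: "int \<Rightarrow> 'a measure" where
  "\<epsilon>_before n \<equiv> generated_sigma M signs \<epsilon> {..<n}"

abbreviation \<eta>_before :: "int \<Rightarrow> 'a measure" where
  "\<eta>_before n \<equiv> generated_sigma M signs \<eta> {..<n}"

abbreviation \<eta>_field :: "'a measure" where
  "\<eta>_field \<equiv> generated_sigma M signs \<eta> UNIV"

lemma \<epsilon>_measurable: "\<epsilon> n \<in> M \<rightarrow>\<^sub>M signs"
  using coin by (auto simp: coin_tossing_def indep_vars_def)

lemma \<epsilon>_adapted: "k \<in> I \<Longrightarrow> \<epsilon> k \<in> generated_sigma M signs \<epsilon> I \<rightarrow>\<^sub>M signs"
  using measurable_space[OF \<epsilon>_measurable] by (intro measurable_generated_sigma) auto

lemma H_measurable: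
  assumes "\<And>k. k < n \<Longrightarrow> \<epsilon> k \<in> N \<rightarrow>\<^sub>M signs"
  shows "H_process h \<epsilon> n \<in> N \<rightarrow>\<^sub>M signs"
proof -
  have "(\<lambda>\<omega>. h n (past (\<lambda>k. \<epsilon> k \<omega>) (n - 1))) \<in> N \<rightarrow>\<^sub>M signs"
    using assms by (intro measurable_compose[OF measurable_past h_measurable]) auto
  then show ?thesis
    by (simp add: H_process_def[abs_def])
qed

lemma \<eta>_measurable_from:
  assumes "\<And>k. k \<le> n \<Longrightarrow> \<epsilon> k \<in> N \<rightarrow>\<^sub>M signs"
  shows "\<eta> n \<in> N \<rightarrow>\<^sub>M signs"
  using assms by (intro measurable_signs_mult H_measurable) auto

lemma \<eta>_measurable: "\<eta> n \<in> M \<rightarrow>\<^sub>M signs"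
  by (intro \<eta>_measurable_from \<epsilon>_measurable)

lemma \<eta>_adapted: "k \<in> I \<Longrightarrow> \<eta> k \<in> generated_sigma M signs \<eta> I \<rightarrow>\<^sub>M signs"
  using measurable_space[OF \<eta>_measurable] by (intro measurable_generated_sigma) auto

lemma subalgebra_\<epsilon>: "subalgebra M (generated_sigma M signs \<epsilon> I)"
  using \<epsilon>_measurable by (intro subalgebra_generated_sigma)

lemma subalgebra_\<eta>: "subalgebra M (generated_sigma M signs \<eta> I)"
  using \<eta>_measurable by (intro subalgebra_generated_sigma)

lemma \<epsilon>_before_mono: "m \<le> n \<Longrightarrow> sets (\<epsilon>_before m) \<subseteq> sets (\<epsilon>_before n)"
  using \<epsilon>_adapted by (intro sets_generated_sigma_subset) auto

lemma \<eta>_before_subset_\<epsilon>_before: "sets (\<eta>_before n) \<subseteq> sets (\<epsilon>_before n)"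
  using \<epsilon>_adapted by (intro sets_generated_sigma_subset \<eta>_measurable_from) auto

lemma \<eta>_before_subset_\<eta>_field: "sets (\<eta>_before n) \<subseteq> sets \<eta>_field"
  using \<eta>_adapted by (intro sets_generated_sigma_subset) auto

lemma fair_\<epsilon>: "fair_given M (\<epsilon>_before n) (\<epsilon> n)"
  unfolding fair_given_def
proof (intro conjI ballI)
  show "subalgebra M (\<epsilon>_before n)" by (rule subalgebra_\<epsilon>)
  show "\<epsilon> n \<in> M \<rightarrow>\<^sub>M signs" by (rule \<epsilon>_measurable)
  fix B and s :: int assume B: "B \<in> sets (\<epsilon>_before n)" and s: "s \<in> {-1, 1}"
  let ?U = "\<lambda>\<omega>. \<lambda>k\<in>{..<n}. \<epsilon> k \<omega>" and ?V = "\<lambda>\<omega>. \<lambda>k\<in>{n}. \<epsilon> k \<omega>"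
  have rv: "\<epsilon> k \<in> space M \<rightarrow> space signs" for k
    using measurable_space[OF \<epsilon>_measurable] by auto
  have U: "?U \<in> space M \<rightarrow> space (PiM {..<n} (\<lambda>_. signs))"
    using rv by (fastforce simp: space_PiM)
  obtain D where D: "D \<in> sets (PiM {..<n} (\<lambda>_. signs))" and B_eq: "B = ?U -` D \<inter> space M"
    using B rv by (auto simp: generated_sigma_eq_vimage_algebra sets_vimage_algebra2[OF U])
  let ?D' = "{n} \<rightarrow>\<^sub>E {s}"
  have restrict_n: "(\<lambda>k\<in>{n}. x k) = (\<lambda>k\<in>{n}. s) \<longleftrightarrow> x n = s" for x
    by (metis restrict_apply' restrict_ext singletonD singletonI)
  have D': "?D' \<in> sets (PiM {n} (\<lambda>_. signs))"
    using s by (intro sets_PiM_I_finite) auto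
  have "indep_var (PiM {..<n} (\<lambda>_. signs)) ?U (PiM {n} (\<lambda>_. signs)) ?V"
    using coin by (intro indep_var_restrict[where I = UNIV]) (auto simp: coin_tossing_def)
  from indep_varD[OF this D D']
  have "prob ((\<lambda>\<omega>. (?U \<omega>, ?V \<omega>)) -` (D \<times> ?D') \<inter> space M) = prob B * prob (?V -` ?D' \<inter> space M)"
    by (simp add: B_eq)
  also have "(\<lambda>\<omega>. (?U \<omega>, ?V \<omega>)) -` (D \<times> ?D') \<inter> space M = B \<inter> \<epsilon> n -` {s}"
    by (auto simp: B_eq restrict_n intro!: restrict_ext)
  also have "?V -` ?D' \<inter> space M = \<epsilon> n -` {s} \<inter> space M"
    by (auto simp: restrict_n intro!: restrict_ext)
  also have "prob (\<epsilon> n -` {s} \<inter> space M) = measure (distr M signs (\<epsilon> n)) {s}"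
    using s by (intro measure_distr[symmetric] \<epsilon>_measurable) auto
  also have "\<dots> = 1 / 2"
    using coin s by (auto simp: coin_tossing_def measure_uniform_count_measure)
  finally have "prob (B \<inter> \<epsilon> n -` {s}) = prob B / 2" by simp
  then show "emeasure M (B \<inter> \<epsilon> n -` {s}) = emeasure M B / 2"
    by (simp add: emeasure_eq_measure divide_ennreal[of _ 2, simplified])
qed

lemma fair_\<eta>: "fair_given M (\<epsilon>_before n) (\<eta> n)"
  by (intro fair_given_mult[OF fair_\<epsilon>] H_measurable \<epsilon>_adapted) auto

lemma distr_\<epsilon>:
  "distr M (PiM UNIV (\<lambda>_. signs)) (\<lambda>\<omega> k. \<epsilon> k \<omega>) = PiM UNIV (\<lambda>_. uniform_count_measure {-1, 1})"
  by (rule distr_fair_sequence[where F = \<epsilon>_before])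
    (auto intro: prob_space_axioms fair_\<epsilon> \<epsilon>_adapted dest: subsetD[OF \<epsilon>_before_mono])

lemma sigma_finite_\<eta>: "sigma_finite_subalgebra M (generated_sigma M signs \<eta> I)"
  by (intro finite_measure_subalgebra_is_sigma_finite finite_measure_subalgebra.intro
      finite_measure_subalgebra_axioms.intro subalgebra_\<eta>) unfold_locales

text \<open>
  Two functions of \<open>\<epsilon>\<close> before \<open>n\<close> with equal integrals over the events of \<open>\<eta>\<close> before \<open>n\<close> also have
  equal integrals over the events of all of \<open>\<eta>\<close>: on a cylinder, the factor due to the times
  from \<open>n\<close> on splits off as the same constant for both functions.
\<close>

lemma nn_integral_\<eta>_field_eqI:
  assumes f: "f \<in> borel_measurable (\<epsilon>_before n)" and g: "g \<in> borel_measurable (\<epsilon>_before n)"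
    and fin: "(\<integral>\<^sup>+\<omega>. f \<omega> \<partial>M) \<noteq> \<infinity>"
    and eq: "\<And>D. D \<in> sets (\<eta>_before n) \<Longrightarrow> (\<integral>\<^sup>+\<omega>\<in>D. f \<omega> \<partial>M) = (\<integral>\<^sup>+\<omega>\<in>D. g \<omega> \<partial>M)"
    and D: "D \<in> sets \<eta>_field"
  shows "(\<integral>\<^sup>+\<omega>\<in>D. f \<omega> \<partial>M) = (\<integral>\<^sup>+\<omega>\<in>D. g \<omega> \<partial>M)"
proof -
  let ?S = "PiM UNIV (\<lambda>_::int. signs)" and ?V = "\<lambda>\<omega> k. \<eta> k \<omega>"
  have V: "?V \<in> M \<rightarrow>\<^sub>M ?S" by (rule measurable_sequence[OF \<eta>_measurable])
  have fM: "f \<in> borel_measurable M" and gM: "g \<in> borel_measurable M"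
    using f g by (blast intro: measurable_from_subalg[OF subalgebra_\<epsilon>])+
  have law: "emeasure (distr (density M u) ?S ?V) X = (\<integral>\<^sup>+\<omega>\<in>?V -` X \<inter> space M. u \<omega> \<partial>M)"
    if "u \<in> borel_measurable M" "X \<in> sets ?S" for u X
    using that V measurable_sets[OF V that(2)] by (simp add: emeasure_distr emeasure_density)
  have "distr (density M f) ?S ?V = distr (density M g) ?S ?V"
  proof (rule measure_eqI_PiM_infinite[where M = "\<lambda>_. signs"])
    show "finite_measure (distr (density M f) ?S ?V)"
      using fin V fM by (intro finite_measureI) (simp add: emeasure_distr emeasure_density measurable_sets
         nn_integral_cong[of M "\<lambda>\<omega>. f \<omega> * indicator (?V -` space ?S \<inter> space M) \<omega>" f] measurable_space[OF V] )
    fix A :: "int \<Rightarrow> int set" and J :: "int set"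
    assume J: "finite J" "J \<subseteq> UNIV" and "\<And>i. i \<in> J \<Longrightarrow> A i \<in> sets signs"
    then have A: "\<And>i. i \<in> J \<Longrightarrow> A i \<subseteq> {-1, 1}" by auto
    let ?X = "prod_emb UNIV (\<lambda>_. signs) J (Pi\<^sub>E J A)"
    \<comment> \<open>A cylinder splits into its part before \<open>n\<close>, which is an event of \<open>\<eta>_before n\<close>, and an independent rest.\<close>
    let ?K = "J \<inter> {..<n}" and ?L = "J \<inter> {n..}"
    let ?D = "{\<omega>\<in>space M. \<forall>j\<in>?K. \<eta> j \<omega> \<in> A j}"
    have X: "?X \<in> sets ?S"
      using J A by (intro sets_PiM_I) auto
    have V_X: "?V -` ?X \<inter> space M = {\<omega>\<in>space M. \<forall>j\<in>J. \<eta> j \<omega> \<in> A j}"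
      using measurable_space[OF \<eta>_measurable]
      by (auto simp: prod_emb_def PiE_iff extensional_def restrict_def)
    have "{\<omega>\<in>space (\<eta>_before n). \<forall>j\<in>?K. \<eta> j \<omega> \<in> A j} \<in> sets (\<eta>_before n)"
    proof (rule sets.sets_Collect_finite_All)
      fix j assume "j \<in> ?K"
      then have "\<eta> j -` A j \<inter> space (\<eta>_before n) \<in> sets (\<eta>_before n)"
        using A by (intro measurable_sets[OF \<eta>_adapted]) auto
      then show "{\<omega>\<in>space (\<eta>_before n). \<eta> j \<omega> \<in> A j} \<in> sets (\<eta>_before n)"
        by (simp add: vimage_def Int_def conj_commute)
    qed (use J in simp)
    then have D: "?D \<in> sets (\<eta>_before n)" by simp
    have J_split: "(\<forall>j\<in>J. P j) \<longleftrightarrow> (\<forall>j\<in>?K. P j) \<and> (\<forall>j\<in>?L. P j)" for P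
      by (metis IntE IntI atLeast_iff lessThan_iff not_le)
    have eval: "emeasure (distr (density M u) ?S ?V) ?X =
        (\<Prod>j\<in>?L. emeasure (uniform_count_measure {-1, 1}) (A j)) * (\<integral>\<^sup>+\<omega>\<in>?D. u \<omega> \<partial>M)"
      if u: "u \<in> borel_measurable (\<epsilon>_before n)" for u
    proof -
      have "emeasure (distr (density M u) ?S ?V) ?X = (\<integral>\<^sup>+\<omega>. u \<omega> * indicator (?V -` ?X \<inter> space M) \<omega> \<partial>M)"
        using u X by (intro law measurable_from_subalg[OF subalgebra_\<epsilon>])
      also have "\<dots> = (\<integral>\<^sup>+\<omega>. u \<omega> * indicator ?D \<omega> * (\<Prod>j\<in>?L. indicator (A j) (\<eta> j \<omega>)) \<partial>M)"
        unfolding V_X J_split prod_indicator_ennreal[OF finite_Int[OF disjI1[OF J(1)]]]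
        by (intro nn_integral_cong) (auto split: split_indicator)
      also have "\<dots> = (\<Prod>j\<in>?L. emeasure (uniform_count_measure {-1, 1}) (A j)) * (\<integral>\<^sup>+\<omega>\<in>?D. u \<omega> \<partial>M)"
      proof (rule nn_integral_fair_cylinder[where F = \<epsilon>_before])
        show "(\<lambda>\<omega>. u \<omega> * indicator ?D \<omega>) \<in> borel_measurable (\<epsilon>_before n)"
          using u D \<eta>_before_subset_\<epsilon>_before[of n]
          by (intro borel_measurable_times_ennreal borel_measurable_indicator) auto
      qed (use J A fair_\<eta> \<epsilon>_before_mono in \<open>auto intro!: \<eta>_measurable_from \<epsilon>_adapted\<close>)
      finally show ?thesis .
    qed
    show "emeasure (distr (density M f) ?S ?V) ?X = emeasure (distr (density M g) ?S ?V) ?X"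
      using eval[OF f] eval[OF g] eq[OF D] by simp
  qed simp_all
  moreover obtain D' where "D' \<in> sets ?S" "D = ?V -` D' \<inter> space M"
  proof -
    have rv: "\<eta> k \<in> space M \<rightarrow> space signs" for k
      using measurable_space[OF \<eta>_measurable] by auto
    have "?V \<in> space M \<rightarrow> space ?S"
      using measurable_space[OF V] by auto
    then show ?thesis
      using D generated_sigma_eq_vimage_algebra[of UNIV \<eta> M signs] rv that
      by (auto simp: sets_vimage_algebra2 restrict_def)
  qed
  ultimately show ?thesis
    using law[OF fM, of D'] law[OF gM, of D'] by simp
qed

text \<open>
  Knowing the noise from time \<open>n\<close> on does not change the conditional probability of an event that
  was decided before \<open>n\<close>. Both the equality of the \<open>\<sigma>\<close>-fields at every time and the Markov
  property of the coupled copies rest on this.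
\<close>

lemma nn_cond_exp_\<eta>_field:
  assumes B: "B \<in> sets (\<epsilon>_before n)"
  shows "AE \<omega> in M. nn_cond_exp M (\<eta>_before n) (indicator B) \<omega> = nn_cond_exp M \<eta>_field (indicator B) \<omega>"
proof -
  interpret past: sigma_finite_subalgebra M "\<eta>_before n" by (rule sigma_finite_\<eta>)
  interpret all: sigma_finite_subalgebra M \<eta>_field by (rule sigma_finite_\<eta>)
  let ?g = "nn_cond_exp M (\<eta>_before n) (indicator B)"
  have BM: "B \<in> sets M" using B subalgebra_\<epsilon> by (auto simp: subalgebra_def)
  have g: "?g \<in> borel_measurable (\<eta>_before n)" by simp
  show ?thesis
  proof (rule all.nn_cond_exp_charact)
    show "?g \<in> borel_measurable \<eta>_field"
      by (rule measurable_finer[OF g]) (use \<eta>_before_subset_\<eta>_field in auto)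
    show "indicator B \<in> borel_measurable M" using BM by simp
    fix D assume "D \<in> sets \<eta>_field"
    then show "(\<integral>\<^sup>+\<omega>\<in>D. indicator B \<omega> \<partial>M) = (\<integral>\<^sup>+\<omega>\<in>D. ?g \<omega> \<partial>M)"
    proof (rule nn_integral_\<eta>_field_eqI[rotated -1])
      show "indicator B \<in> borel_measurable (\<epsilon>_before n)" using B by simp
      show "?g \<in> borel_measurable (\<epsilon>_before n)"
        by (rule measurable_finer[OF g]) (use \<eta>_before_subset_\<epsilon>_before in auto)
      show "(\<integral>\<^sup>+\<omega>. indicator B \<omega> \<partial>M) \<noteq> \<infinity>" using BM by simp
      fix D assume "D \<in> sets (\<eta>_before n)"
      then show "(\<integral>\<^sup>+\<omega>\<in>D. indicator B \<omega> \<partial>M) = (\<integral>\<^sup>+\<omega>\<in>D. ?g \<omega> \<partial>M)"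
        using past.nn_cond_exp_intg[of "indicator D" "indicator B"] BM by (simp add: mult.commute)
    qed
  qed
qed

lemma F_at_\<eta>_subset: "F_at M \<eta> n \<subseteq> F_at M \<epsilon> n"
  by (rule completed_sigma_subset, rule vimage_mem_completed_sigma)
    (auto intro!: \<eta>_measurable_from \<epsilon>_adapted)

lemma F_infinity_\<eta>_subset: "F_infinity M \<eta> \<subseteq> F_infinity M \<epsilon>"
  by (rule completed_sigma_subset, rule vimage_mem_completed_sigma)
    (auto intro!: \<eta>_measurable_from \<epsilon>_adapted)

text \<open>
  If \<open>B\<close> is an event of the noise up to null sets, then \<open>P(B | \<eta>)\<close> is its indicator. For \<open>B\<close>
  decided before \<open>n + 1\<close> it is also \<open>P(B | \<eta> before n + 1)\<close>, and so \<open>B\<close> is almost surely the event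
  that the latter equals \<open>1\<close>.
\<close>

lemma F_at_eq_if_F_infinity_eq:
  assumes "F_infinity M \<eta> = F_infinity M \<epsilon>"
  shows "F_at M \<eta> n = F_at M \<epsilon> n"
proof (rule antisym[OF F_at_\<eta>_subset])
  interpret all: sigma_finite_subalgebra M \<eta>_field by (rule sigma_finite_\<eta>)
  show "F_at M \<epsilon> n \<subseteq> F_at M \<eta> n"
  proof (rule completed_sigma_subset)
    fix k and A :: "int set" assume k: "k \<in> {..n}" and A: "A \<subseteq> {-1, 1}"
    let ?B = "\<epsilon> k -` A \<inter> space M" and ?g = "nn_cond_exp M (\<eta>_before (n + 1)) (indicator (\<epsilon> k -` A \<inter> space M))"
    have B: "?B \<in> sets (\<epsilon>_before (n + 1))"
      using measurable_sets[OF \<epsilon>_adapted, of k "{..<n + 1}" A] k A by auto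
    then have BM: "?B \<in> sets M" using subalgebra_\<epsilon> by (auto simp: subalgebra_def)
    have "?B \<in> F_infinity M \<eta>"
      unfolding assms using A by (intro vimage_mem_completed_sigma \<epsilon>_adapted) auto
    then obtain C where C: "C \<in> sets \<eta>_field" and BC: "AE \<omega> in M. \<omega> \<in> ?B \<longleftrightarrow> \<omega> \<in> C"
      unfolding mem_completed_sigma_iff by blast
    have CM: "C \<in> sets M" using C subalgebra_\<eta> by (auto simp: subalgebra_def)
    have "AE \<omega> in M. (indicator ?B \<omega> :: ennreal) = indicator C \<omega>"
      using BC by eventually_elim (simp add: indicator_def)
    then have "AE \<omega> in M. nn_cond_exp M \<eta>_field (indicator ?B) \<omega> = nn_cond_exp M \<eta>_field (indicator C) \<omega>"
      using BM CM by (intro all.nn_cond_exp_cong) auto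
    moreover have "AE \<omega> in M. indicator C \<omega> = nn_cond_exp M \<eta>_field (indicator C) \<omega>"
      using C by (intro all.nn_cond_exp_F_meas) auto
    ultimately have "AE \<omega> in M. \<omega> \<in> ?B \<longleftrightarrow> \<omega> \<in> {\<omega>\<in>space M. ?g \<omega> = 1}"
      using BC nn_cond_exp_\<eta>_field[OF B] AE_space
      by eventually_elim (auto simp: indicator_def split: if_splits)
    moreover have "{\<omega>\<in>space M. ?g \<omega> = 1} \<in> sets (\<eta>_before (n + 1))"
      using measurable_sets[OF borel_measurable_nn_cond_exp[of M "\<eta>_before (n + 1)" "indicator ?B"], of "{1}"]
      by (simp add: vimage_def Int_def conj_commute)
    moreover have "{..<n + 1} = {..n}" by auto
    ultimately show "?B \<in> F_at M \<eta> n"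
      unfolding mem_completed_sigma_iff by (intro conjI bexI[of _ "{\<omega>\<in>space M. ?g \<omega> = 1}"]) simp_all
  qed
qed

lemma F_infinity_eq_if_F_at_eq:
  assumes "\<And>n. F_at M \<eta> n = F_at M \<epsilon> n"
  shows "F_infinity M \<eta> = F_infinity M \<epsilon>"
proof (rule antisym[OF F_infinity_\<eta>_subset], rule completed_sigma_subset)
  fix k and A :: "int set" assume A: "A \<subseteq> {-1, 1}"
  have "\<epsilon> k -` A \<inter> space M \<in> F_at M \<eta> k"
    unfolding assms using A by (intro vimage_mem_completed_sigma \<epsilon>_adapted) auto
  also have "\<dots> \<subseteq> F_infinity M \<eta>"
    by (rule completed_sigma_subset, rule vimage_mem_completed_sigma) (auto intro!: \<eta>_adapted)
  finally show "\<epsilon> k -` A \<inter> space M \<in> F_infinity M \<eta>" .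
qed

end

section \<open>The driving noise of a sign sequence\<close>

text \<open>
  The noise read off from a trajectory: for the trajectory of \<open>\<epsilon>\<close> it is \<open>\<eta>\<close>, and
  \<open>past_eq_f_step_innovation\<close> says that \<open>f_step\<close> driven by it recovers the trajectory.
\<close>

definition innovation :: "(int \<Rightarrow> sign_seq \<Rightarrow> int) \<Rightarrow> (int \<Rightarrow> int) \<Rightarrow> int \<Rightarrow> int" where
  "innovation h z n = h n (past z (n - 1)) * z n"

lemma f_step_apply: "k \<le> 0 \<Longrightarrow> f_step h n \<alpha> x k = (if k = 0 then \<alpha> * h n x else x (k + 1))"
  by (simp add: f_step_def)

lemma f_step_in_space:
  assumes "h n \<in> E \<rightarrow>\<^sub>M signs" "\<alpha> \<in> {-1, 1}" "x \<in> space E"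
  shows "f_step h n \<alpha> x \<in> space E"
  using measurable_space[OF assms(1,3)] assms(2,3)
  by (auto simp: f_step_def E_def space_PiM PiE_iff)

lemma measurable_E_component: "k \<le> 0 \<Longrightarrow> (\<lambda>x. x k) \<in> E \<rightarrow>\<^sub>M signs"
  unfolding E_def by (rule measurable_component_singleton) simp

lemma enn2real_half: "enn2real (inverse 2) = 1 / 2" "enn2real (1 / 2) = 1 / 2"
proof -
  have "inverse 2 = ennreal (1 / 2)"
    using inverse_ennreal[of 2] by (simp add: inverse_eq_divide)
  then show *: "enn2real (inverse 2) = 1 / 2"
    by (metis enn2real_ennreal half_gt_zero_iff less_eq_real_def zero_less_one)
  then show "enn2real (1 / 2) = 1 / 2"
    by (simp add: divide_ennreal_def)
qed

lemma measure_pair_kernel: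
  "A \<in> sets E2 \<Longrightarrow> measure (pair_kernel h n (a, b)) A =
    (indicator A (f_step h n 1 a, f_step h n 1 b) + indicator A (f_step h n (-1) a, f_step h n (-1) b)) / 2"
  unfolding measure_def emeasure_pair_kernel
  by (auto simp: indicator_def enn2real_half ennreal_divide_self)

lemma past_apply_0 [simp]: "past z n 0 = z n"
  by (simp add: past_def)

lemma innovation_measurable:
  assumes "\<And>n. h n \<in> E \<rightarrow>\<^sub>M signs" "\<And>k. k \<le> n \<Longrightarrow> (\<lambda>\<omega>. f \<omega> k) \<in> N \<rightarrow>\<^sub>M signs"
  shows "(\<lambda>\<omega>. innovation h (f \<omega>) n) \<in> N \<rightarrow>\<^sub>M signs"
  unfolding innovation_def
  using assms measurable_past[of "n - 1" "\<lambda>k \<omega>. f \<omega> k" N]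
  by (intro measurable_signs_mult measurable_compose[OF _ assms(1)]) auto

lemma past_eq_f_step_innovation:
  assumes "z \<in> space sign_sequences" "\<And>n. h n \<in> E \<rightarrow>\<^sub>M signs"
  shows "past z n = f_step h n (innovation h z n) (past z (n - 1))"
proof
  fix k
  have "past z (n - 1) \<in> space E"
    using assms(1) by (auto simp: past_def E_def space_PiM)
  then have "h n (past z (n - 1)) \<in> {-1, 1}"
    using measurable_space[OF assms(2)] by auto
  \<comment> \<open>A sign is its own inverse.\<close>
  then have "h n (past z (n - 1)) * z n * h n (past z (n - 1)) = z n"
    by auto
  then show "past z n k = f_step h n (innovation h z n) (past z (n - 1)) k"
    by (auto simp: past_def f_step_def innovation_def)
qed

lemma measurable_f_step:
  assumes "h n \<in> E \<rightarrow>\<^sub>M signs" "\<alpha> \<in> {-1, 1}"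
  shows "f_step h n \<alpha> \<in> E \<rightarrow>\<^sub>M E"
proof -
  have "(\<lambda>x. \<lambda>k\<in>{..0}. if k = 0 then \<alpha> * h n x else x (k + 1)) \<in> E \<rightarrow>\<^sub>M PiM {..0} (\<lambda>_. signs)"
  proof (rule measurable_restrict)
    fix k :: int assume "k \<in> {..0}"
    then show "(\<lambda>x. if k = 0 then \<alpha> * h n x else x (k + 1)) \<in> E \<rightarrow>\<^sub>M signs"
      using measurable_signs_mult[OF _ assms(1), of "\<lambda>_. \<alpha>"] assms(2) measurable_E_component[of "k + 1"]
      by (cases "k = 0") auto
  qed
  then show ?thesis by (simp add: f_step_def[abs_def] flip: E_def)
qed

section \<open>Chains with the transition kernels\<close>

locale sign_chain = prob_space P for P :: "'b measure" +
  fixes h :: "int \<Rightarrow> sign_seq \<Rightarrow> int" and X Y :: "int \<Rightarrow> 'b \<Rightarrow> sign_seq"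
  assumes chain: "markov_chain h P X Y" and h_measurable: "\<And>n. h n \<in> E \<rightarrow>\<^sub>M signs"
begin

abbreviation before :: "int \<Rightarrow> 'b measure" where
  "before n \<equiv> generated_sigma P E2 (\<lambda>k \<omega>. (X k \<omega>, Y k \<omega>)) {..n - 1}"

lemma state_measurable: "(\<lambda>\<omega>. (X n \<omega>, Y n \<omega>)) \<in> P \<rightarrow>\<^sub>M E2"
  using chain by (intro measurable_Pair) (auto simp: markov_chain_def)

lemma subalgebra_before: "subalgebra P (before n)"
  using state_measurable by (intro subalgebra_generated_sigma)

lemma state_adapted: "k < n \<Longrightarrow> (\<lambda>\<omega>. (X k \<omega>, Y k \<omega>)) \<in> before n \<rightarrow>\<^sub>M E2"
  using measurable_space[OF state_measurable] by (intro measurable_generated_sigma) auto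

lemma before_mono: "m \<le> n \<Longrightarrow> sets (before m) \<subseteq> sets (before n)"
  using state_adapted by (intro sets_generated_sigma_subset) auto

text \<open>
  The form in which the Markov property is used: where the transition probability into \<open>A\<close> is
  constant on an event \<open>C\<close> of the past, it is the conditional probability given \<open>C\<close>.
\<close>

lemma prob_step:
  assumes A: "A \<in> sets E2" and C: "C \<in> sets (before n)"
    and c: "\<And>p. p \<in> space E2 \<Longrightarrow> measure (pair_kernel h n p) A = c p"
    and c': "\<And>\<omega>. \<omega> \<in> C \<Longrightarrow> c (X (n - 1) \<omega>, Y (n - 1) \<omega>) = d"
  shows "prob (C \<inter> (\<lambda>\<omega>. (X n \<omega>, Y n \<omega>)) -` A) = d * prob C"
proof -
  interpret sigma_finite_subalgebra P "before n"
    by (intro finite_measure_subalgebra_is_sigma_finite finite_measure_subalgebra.intro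
        finite_measure_subalgebra_axioms.intro subalgebra_before) unfold_locales
  let ?f = "\<lambda>\<omega>. indicator A (X n \<omega>, Y n \<omega>) :: real"
  have CP: "C \<in> sets P" using C subalgebra_before by (auto simp: subalgebra_def)
  have f: "?f \<in> borel_measurable P"
    using A by (intro measurable_compose[OF state_measurable]) simp
  have int: "integrable P ?f"
    by (rule integrable_const_bound[where B = 1, OF _ f]) simp
  have CA: "C \<inter> (\<lambda>\<omega>. (X n \<omega>, Y n \<omega>)) -` A \<in> sets P"
  proof -
    have "C \<inter> (\<lambda>\<omega>. (X n \<omega>, Y n \<omega>)) -` A = C \<inter> ((\<lambda>\<omega>. (X n \<omega>, Y n \<omega>)) -` A \<inter> space P)"
      using sets.sets_into_space[OF CP] by auto
    then show ?thesis using CP measurable_sets[OF state_measurable A] by auto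
  qed
  have "prob (C \<inter> (\<lambda>\<omega>. (X n \<omega>, Y n \<omega>)) -` A) = (\<integral>\<omega>. indicator (C \<inter> (\<lambda>\<omega>. (X n \<omega>, Y n \<omega>)) -` A) \<omega> \<partial>P)"
    using CA by simp
  also have "\<dots> = (\<integral>\<omega>\<in>C. ?f \<omega> \<partial>P)"
    unfolding set_lebesgue_integral_def by (intro Bochner_Integration.integral_cong) (auto split: split_indicator)
  also have "\<dots> = (\<integral>\<omega>\<in>C. real_cond_exp P (before n) ?f \<omega> \<partial>P)"
    by (rule real_cond_exp_intA[OF int C])
  also have "\<dots> = (\<integral>\<omega>. d * indicator C \<omega> \<partial>P)"
    unfolding set_lebesgue_integral_def
  proof (rule integral_cong_AE)
    have "AE \<omega> in P. real_cond_exp P (before n) ?f \<omega> = measure (pair_kernel h n (X (n - 1) \<omega>, Y (n - 1) \<omega>)) A"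
      using chain A unfolding markov_chain_def by blast
    then show "AE \<omega> in P. indicator C \<omega> *\<^sub>R real_cond_exp P (before n) ?f \<omega> = d * indicator C \<omega>"
      using AE_space
    proof eventually_elim
      case (elim \<omega>)
      then show ?case
        using c[OF measurable_space[OF state_measurable, of \<omega> "n - 1"]] c'[of \<omega>]
        by (auto split: split_indicator)
    qed
  qed (use CP in auto)
  also have "\<dots> = d * prob C" using CP by simp
  finally show ?thesis .
qed

text \<open>
  A sign of the new state that both values of the noise set to the same value \<open>g\<close> of the old
  state has that value almost surely: on the event that \<open>g\<close> takes the value \<open>s\<close>, the
  transition probability into the set where \<open>g'\<close> takes the value \<open>s\<close> is \<open>1\<close>.
\<close>

lemma AE_transport:
  assumes g: "g \<in> E2 \<rightarrow>\<^sub>M signs" and g': "g' \<in> E2 \<rightarrow>\<^sub>M signs"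
    and eq: "\<And>a b \<alpha>. a \<in> space E \<Longrightarrow> b \<in> space E \<Longrightarrow> \<alpha> \<in> {-1, 1} \<Longrightarrow>
      g' (f_step h n \<alpha> a, f_step h n \<alpha> b) = g (a, b)"
  shows "AE \<omega> in P. g' (X n \<omega>, Y n \<omega>) = g (X (n - 1) \<omega>, Y (n - 1) \<omega>)"
proof -
  have *: "AE \<omega> in P. g (X (n - 1) \<omega>, Y (n - 1) \<omega>) = s \<longrightarrow> g' (X n \<omega>, Y n \<omega>) = s"
    if s: "s \<in> {-1, 1}" for s
  proof -
    let ?C = "(\<lambda>\<omega>. g (X (n - 1) \<omega>, Y (n - 1) \<omega>)) -` {s} \<inter> space (before n)"
    let ?A = "g' -` {s} \<inter> space E2"
    have C: "?C \<in> sets (before n)"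
      using s by (intro measurable_sets[OF measurable_compose[OF state_adapted g]]) auto
    have A: "?A \<in> sets E2"
      using s by (intro measurable_sets[OF g']) auto
    have CP: "?C \<in> sets P" using C subalgebra_before by (auto simp: subalgebra_def)
    have "prob (?C \<inter> (\<lambda>\<omega>. (X n \<omega>, Y n \<omega>)) -` ?A) = 1 * prob ?C"
    proof (rule prob_step[OF A C, where c = "\<lambda>p. if g p = s then 1 else 0"])
      fix p assume "p \<in> space E2"
      then obtain a b where p: "p = (a, b)" "a \<in> space E" "b \<in> space E"
        by (auto simp: space_pair_measure)
      have "(f_step h n \<alpha> a, f_step h n \<alpha> b) \<in> ?A \<longleftrightarrow> g p = s" if "\<alpha> \<in> {-1, 1}" for \<alpha>
        using f_step_in_space[of h n, OF h_measurable that] p eq[OF p(2,3) that]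
        by (simp add: space_pair_measure)
      from this[of 1] this[of "-1"] show "measure (pair_kernel h n p) ?A = (if g p = s then 1 else 0)"
        unfolding p(1) measure_pair_kernel[OF A] by (simp add: indicator_def)
    qed auto
    moreover have "?C \<inter> (\<lambda>\<omega>. (X n \<omega>, Y n \<omega>)) -` ?A = ?C \<inter> ((\<lambda>\<omega>. (X n \<omega>, Y n \<omega>)) -` ?A \<inter> space P)"
      by auto
    ultimately have "prob (?C - ((\<lambda>\<omega>. (X n \<omega>, Y n \<omega>)) -` ?A \<inter> space P)) = 0"
      using finite_measure_Diff'[OF CP measurable_sets[OF state_measurable A, of n]] by simp
    then have "AE \<omega> in P. \<omega> \<notin> ?C - ((\<lambda>\<omega>. (X n \<omega>, Y n \<omega>)) -` ?A \<inter> space P)"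
      using CP measurable_sets[OF state_measurable A, of n]
      by (intro AE_not_in) (auto simp: null_sets_def emeasure_eq_measure)
    then show ?thesis
      using AE_space by eventually_elim auto
  qed
  show ?thesis
    using *[of 1, simplified] *[of "-1", simplified] AE_space
  proof eventually_elim
    case (elim \<omega>)
    then show ?case
      using measurable_space[OF g measurable_space[OF state_measurable, of \<omega> "n - 1"]] by auto
  qed
qed

text \<open>
  A sign of the new state that changes with the noise takes each of its two values for exactly
  one value of the noise.
\<close>

lemma fair_if_odd:
  assumes g: "g \<in> E2 \<rightarrow>\<^sub>M signs"
    and odd: "\<And>a b. a \<in> space E \<Longrightarrow> b \<in> space E \<Longrightarrow>
      g (f_step h n (-1) a, f_step h n (-1) b) = - g (f_step h n 1 a, f_step h n 1 b)"
  shows "fair_given P (before n) (\<lambda>\<omega>. g (X n \<omega>, Y n \<omega>))"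
  unfolding fair_given_def
proof (intro conjI ballI)
  show "subalgebra P (before n)" by (rule subalgebra_before)
  show "(\<lambda>\<omega>. g (X n \<omega>, Y n \<omega>)) \<in> P \<rightarrow>\<^sub>M signs"
    by (rule measurable_compose[OF state_measurable g])
  fix B and s :: int assume B: "B \<in> sets (before n)" and s: "s \<in> {-1, 1}"
  let ?A = "g -` {s} \<inter> space E2"
  have A: "?A \<in> sets E2"
    using s by (intro measurable_sets[OF g]) auto
  have "prob (B \<inter> (\<lambda>\<omega>. (X n \<omega>, Y n \<omega>)) -` ?A) = 1 / 2 * prob B"
  proof (rule prob_step[OF A B, where c = "\<lambda>p. 1 / 2"])
    fix p assume "p \<in> space E2"
    then obtain a b where p: "p = (a, b)" "a \<in> space E" "b \<in> space E"
      by (auto simp: space_pair_measure)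
    have space: "(f_step h n \<alpha> a, f_step h n \<alpha> b) \<in> space E2" if "\<alpha> \<in> {-1, 1}" for \<alpha>
      using f_step_in_space[of h n, OF h_measurable that] p by (auto simp: space_pair_measure)
    have "g (f_step h n 1 a, f_step h n 1 b) \<in> {-1, 1}"
      using measurable_space[OF g space[of 1]] by auto
    then show "measure (pair_kernel h n p) ?A = 1 / 2"
      using s space[of 1] space[of "-1"] odd[OF p(2,3)]
      unfolding p(1) measure_pair_kernel[OF A] by (auto simp: indicator_def)
  qed auto
  also have "B \<inter> (\<lambda>\<omega>. (X n \<omega>, Y n \<omega>)) -` ?A = B \<inter> (\<lambda>\<omega>. g (X n \<omega>, Y n \<omega>)) -` {s}"
    using sets.sets_into_space[OF B] measurable_space[OF state_measurable] by auto
  finally show "emeasure P (B \<inter> (\<lambda>\<omega>. g (X n \<omega>, Y n \<omega>)) -` {s}) = emeasure P B / 2"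
    using divide_ennreal[of "prob B" 2] by (simp add: emeasure_eq_measure)
qed

text \<open>
  The states of one coordinate are the successive pasts of a single sequence of signs, because a
  step only shifts the old entries; and this sequence is fair. The projection \<open>\<pi>\<close> serves to treat
  the two coordinates at once.
\<close>

lemma coordinate_process:
  fixes \<pi> :: "sign_seq \<times> sign_seq \<Rightarrow> sign_seq"
  assumes \<pi>: "\<pi> = fst \<or> \<pi> = snd"
  defines "z \<equiv> \<lambda>k \<omega>. \<pi> (X k \<omega>, Y k \<omega>) 0"
  shows AE_coordinate_eq_past: "AE \<omega> in P. \<forall>n. \<pi> (X n \<omega>, Y n \<omega>) = past (\<lambda>k. z k \<omega>) n"
    and distr_coordinate: "distr P (PiM UNIV (\<lambda>_. signs)) (\<lambda>\<omega> k. z k \<omega>) =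
      PiM UNIV (\<lambda>_. uniform_count_measure {-1, 1})"
proof -
  have \<pi>_meas: "\<pi> \<in> E2 \<rightarrow>\<^sub>M E" using \<pi> by auto
  have comp: "(\<lambda>p. \<pi> p k) \<in> E2 \<rightarrow>\<^sub>M signs" if "k \<le> 0" for k
    by (rule measurable_compose[OF \<pi>_meas measurable_E_component[OF that]])
  have \<pi>_step: "\<pi> (f_step h n \<alpha> a, f_step h n \<alpha> b) = f_step h n \<alpha> (\<pi> (a, b))" for n \<alpha> a b
    using \<pi> by auto
  have shift: "AE \<omega> in P. \<pi> (X n \<omega>, Y n \<omega>) k = \<pi> (X (n - 1) \<omega>, Y (n - 1) \<omega>) (k + 1)" if "k < 0" for n k
    using that by (intro AE_transport[where g = "\<lambda>p. \<pi> p (k + 1)" and g' = "\<lambda>p. \<pi> p k"] comp)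
      (auto simp: \<pi>_step f_step_apply)
  have "AE \<omega> in P. \<pi> (X n \<omega>, Y n \<omega>) (- int m) = z (n - int m) \<omega>" for n m
  proof (induction m arbitrary: n)
    case 0
    then show ?case by (simp add: z_def)
  next
    case (Suc m)
    have "- int (Suc m) < 0" by simp
    from shift[OF this, of n] Suc[of "n - 1"] show ?case by eventually_elim (simp add: algebra_simps)
  qed
  then have "AE \<omega> in P. \<forall>n m. \<pi> (X n \<omega>, Y n \<omega>) (- int m) = z (n - int m) \<omega>"
    by (simp add: AE_all_countable)
  then show "AE \<omega> in P. \<forall>n. \<pi> (X n \<omega>, Y n \<omega>) = past (\<lambda>k. z k \<omega>) n"
    using AE_space
  proof eventually_elim
    case (elim \<omega>)
    show ?case
    proof (intro allI ext)
      fix n k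
      have "\<pi> (X n \<omega>, Y n \<omega>) \<in> space E"
        using measurable_space[OF \<pi>_meas measurable_space[OF state_measurable elim(2)]] .
      then have "\<pi> (X n \<omega>, Y n \<omega>) k = undefined" if "\<not> k \<le> 0"
        using that by (auto simp: E_def space_PiM PiE_iff extensional_def)
      moreover have "\<pi> (X n \<omega>, Y n \<omega>) k = z (n + k) \<omega>" if "k \<le> 0"
        using spec[OF spec[OF elim(1), of n], of "nat (- k)"] that by simp
      ultimately show "\<pi> (X n \<omega>, Y n \<omega>) k = past (\<lambda>k. z k \<omega>) n k"
        by (simp add: past_def)
    qed
  qed
  show "distr P (PiM UNIV (\<lambda>_. signs)) (\<lambda>\<omega> k. z k \<omega>) = PiM UNIV (\<lambda>_. uniform_count_measure {-1, 1})"
  proof (rule distr_fair_sequence[where F = before, OF prob_space_axioms])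
    show "fair_given P (before k) (z k)" for k
      unfolding z_def by (rule fair_if_odd[OF comp]) (simp_all add: \<pi>_step f_step_apply)
    show "z j \<in> before k \<rightarrow>\<^sub>M signs" if "j < k" for j k
      unfolding z_def by (rule measurable_compose[OF state_adapted[OF that] comp]) simp
  qed (rule before_mono)
qed

text \<open>
  The kernel applies the same sign \<open>\<alpha>\<close> to both coordinates. As \<open>\<alpha>\<close> is not part of the state, this
  is expressed through the product of the two new entries, in which \<open>\<alpha>\<close> cancels.
\<close>

lemma AE_innovation_eq:
  "AE \<omega> in P. innovation h (\<lambda>k. X k \<omega> 0) = innovation h (\<lambda>k. Y k \<omega> 0)"
proof -
  have c: "(\<lambda>p. fst p k) \<in> E2 \<rightarrow>\<^sub>M signs" "(\<lambda>p. snd p k) \<in> E2 \<rightarrow>\<^sub>M signs" if "k \<le> 0" for k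
    using measurable_compose[OF measurable_fst measurable_E_component[OF that]]
      measurable_compose[OF measurable_snd measurable_E_component[OF that]] .
  have "AE \<omega> in P. X n \<omega> 0 * Y n \<omega> 0 = h n (X (n - 1) \<omega>) * h n (Y (n - 1) \<omega>)" for n
  proof -
    have "AE \<omega> in P. (\<lambda>p. fst p 0 * snd p 0) (X n \<omega>, Y n \<omega>) =
        (\<lambda>p. h n (fst p) * h n (snd p)) (X (n - 1) \<omega>, Y (n - 1) \<omega>)"
      using h_measurable c
      by (intro AE_transport measurable_signs_mult measurable_compose[OF measurable_fst h_measurable]
          measurable_compose[OF measurable_snd h_measurable])
        (auto simp: f_step_apply)
    then show ?thesis by simp
  qed
  then have "AE \<omega> in P. \<forall>n. X n \<omega> 0 * Y n \<omega> 0 = h n (X (n - 1) \<omega>) * h n (Y (n - 1) \<omega>)"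
    by (simp add: AE_all_countable)
  then show ?thesis
    using AE_coordinate_eq_past[of fst, simplified] AE_coordinate_eq_past[of snd, simplified] AE_space
  proof eventually_elim
    case (elim \<omega>)
    show ?case
    proof
      fix n
      have sp: "X k \<omega> \<in> space E" "Y k \<omega> \<in> space E" for k
        using measurable_space[OF state_measurable elim(4), of k] by (auto simp: space_pair_measure)
      have h_pm: "h n (X (n - 1) \<omega>) \<in> {-1, 1}" "h n (Y (n - 1) \<omega>) \<in> {-1, 1}"
        using measurable_space[OF h_measurable sp(1)] measurable_space[OF h_measurable sp(2)] by auto
      have pm: "X n \<omega> 0 \<in> {-1, 1}" "Y n \<omega> 0 \<in> {-1, 1}"
        using measurable_space[OF measurable_E_component sp(1)] measurable_space[OF measurable_E_component sp(2)]
        by auto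
      have "X n \<omega> 0 * Y n \<omega> 0 = h n (X (n - 1) \<omega>) * h n (Y (n - 1) \<omega>)"
        using elim(1) by blast
      then have "h n (X (n - 1) \<omega>) * X n \<omega> 0 = h n (Y (n - 1) \<omega>) * Y n \<omega> 0"
        using h_pm pm by auto
      then show "innovation h (\<lambda>k. X k \<omega> 0) n = innovation h (\<lambda>k. Y k \<omega> 0) n"
        unfolding innovation_def spec[OF elim(2), symmetric] spec[OF elim(3), symmetric] .
    qed
  qed
qed

end

context sign_change begin

text \<open>
  Under the hypothesis there is, for each \<open>k\<close>, a set \<open>D\<close> of noise sequences such that almost surely
  \<open>\<epsilon> k = 1\<close> exactly if the noise lies in \<open>D\<close>. This is a property of the law of \<open>\<epsilon>\<close>, which both
  coordinates of the chain share, and their noises agree.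
\<close>

lemma chain_on_diagonal:
  fixes P :: "'b measure"
  assumes eq: "F_infinity M \<eta> = F_infinity M \<epsilon>" and chain: "markov_chain h P X Y"
  shows "AE \<omega> in P. \<forall>n. X n \<omega> = Y n \<omega>"
proof -
  interpret C: sign_chain P h X Y
    using chain h_measurable by (intro sign_chain.intro sign_chain_axioms.intro) (auto simp: markov_chain_def)
  let ?S = "PiM UNIV (\<lambda>_::int. signs)"
  let ?x = "\<lambda>\<omega> k. X k \<omega> 0" and ?y = "\<lambda>\<omega> k. Y k \<omega> 0"
  have E: "(\<lambda>\<omega> k. \<epsilon> k \<omega>) \<in> M \<rightarrow>\<^sub>M ?S" by (rule measurable_sequence[OF \<epsilon>_measurable])
  have x: "?x \<in> P \<rightarrow>\<^sub>M ?S" and y: "?y \<in> P \<rightarrow>\<^sub>M ?S"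
    using chain by (auto simp: markov_chain_def intro!: measurable_sequence measurable_compose[OF _ measurable_E_component])
  have laws: "distr P ?S ?x = distr M ?S (\<lambda>\<omega> k. \<epsilon> k \<omega>)" "distr P ?S ?y = distr M ?S (\<lambda>\<omega> k. \<epsilon> k \<omega>)"
    using C.distr_coordinate[of fst] C.distr_coordinate[of snd] distr_\<epsilon> by simp_all
  have innov: "innovation h \<in> ?S \<rightarrow>\<^sub>M ?S"
    using measurable_sequence[of "\<lambda>n z. innovation h z n" ?S signs]
    by (simp add: innovation_measurable h_measurable)
  have recover: "\<exists>D\<in>sets ?S. AE z in distr M ?S (\<lambda>\<omega> k. \<epsilon> k \<omega>). z k = 1 \<longleftrightarrow> innovation h z \<in> D" for k
  proof -
    have "\<epsilon> k -` {1} \<inter> space M \<in> F_infinity M \<eta>"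
      unfolding eq by (intro vimage_mem_completed_sigma \<epsilon>_adapted) auto
    then obtain C where C: "C \<in> sets \<eta>_field" and AE: "AE \<omega> in M. \<omega> \<in> \<epsilon> k -` {1} \<inter> space M \<longleftrightarrow> \<omega> \<in> C"
      unfolding mem_completed_sigma_iff by blast
    have "(\<lambda>\<omega> k. \<eta> k \<omega>) \<in> space M \<rightarrow> space ?S"
      using measurable_space[OF measurable_sequence[OF \<eta>_measurable]] by auto
    then obtain D where D: "D \<in> sets ?S" "C = (\<lambda>\<omega> k. \<eta> k \<omega>) -` D \<inter> space M"
      using C generated_sigma_eq_vimage_algebra[of UNIV \<eta> M signs] measurable_space[OF \<eta>_measurable]
      by (auto simp: sets_vimage_algebra2 restrict_def)
    have "AE \<omega> in M. \<epsilon> k \<omega> = 1 \<longleftrightarrow> innovation h (\<lambda>k. \<epsilon> k \<omega>) \<in> D"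
      using AE AE_space by eventually_elim (simp add: D(2) innovation_def[abs_def] H_process_def)
    moreover have "{z\<in>space ?S. z k = 1 \<longleftrightarrow> innovation h z \<in> D} \<in> sets ?S"
    proof -
      have "(\<lambda>z. z k) -` {1} \<inter> space ?S \<in> sets ?S" "innovation h -` D \<inter> space ?S \<in> sets ?S"
        using measurable_sets[OF innov D(1)] measurable_sets[of "\<lambda>z. z k" ?S signs "{1}"] by auto
      moreover have "{z\<in>space ?S. z k = 1 \<longleftrightarrow> innovation h z \<in> D} =
          space ?S - (((\<lambda>z. z k) -` {1} \<inter> space ?S - innovation h -` D \<inter> space ?S) \<union>
            (innovation h -` D \<inter> space ?S - (\<lambda>z. z k) -` {1} \<inter> space ?S))"
        by auto
      ultimately show ?thesis by auto
    qed
    ultimately show ?thesis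
      using D(1) by (intro bexI[of _ D]) (simp_all add: AE_distr_iff[OF E])
  qed
  have "AE \<omega> in P. X k \<omega> 0 = Y k \<omega> 0" for k
  proof -
    obtain D where D: "AE z in distr M ?S (\<lambda>\<omega> k. \<epsilon> k \<omega>). z k = 1 \<longleftrightarrow> innovation h z \<in> D"
      using recover by blast
    show ?thesis
      using AE_distrD[OF x D[folded laws(1)]] AE_distrD[OF y D[folded laws(2)]] C.AE_innovation_eq AE_space
    proof eventually_elim
      case (elim \<omega>)
      then show ?case
        using measurable_space[OF measurable_compose[OF x measurable_component_singleton], of k \<omega>]
          measurable_space[OF measurable_compose[OF y measurable_component_singleton], of k \<omega>] by auto
    qed
  qed
  then have "AE \<omega> in P. \<forall>k. X k \<omega> 0 = Y k \<omega> 0"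
    by (simp add: AE_all_countable)
  then show ?thesis
    using C.AE_coordinate_eq_past[of fst, simplified] C.AE_coordinate_eq_past[of snd, simplified]
  proof eventually_elim
    case (elim \<omega>)
    show ?case
    proof
      fix n
      have "X n \<omega> = past (\<lambda>k. X k \<omega> 0) n" using elim(2) by (rule spec)
      also have "(\<lambda>k. X k \<omega> 0) = (\<lambda>k. Y k \<omega> 0)" using elim(1) by (intro ext) (rule spec)
      also have "past (\<lambda>k. Y k \<omega> 0) n = Y n \<omega>" using elim(3)[THEN spec, of n] by (rule sym)
      finally show "X n \<omega> = Y n \<omega>" .
    qed
  qed
qed

end

text \<open>
  The defining property of a chain with the conditional expectation integrated out, so that it can be
  verified, and carried to an image measure, by comparing probabilities of events.
\<close>

lemma markov_chainI:
  assumes "prob_space P" and X: "\<And>n. X n \<in> P \<rightarrow>\<^sub>M E" and Y: "\<And>n. Y n \<in> P \<rightarrow>\<^sub>M E"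
    and h: "\<And>n. h n \<in> E \<rightarrow>\<^sub>M signs"
    and step: "\<And>n A C. A \<in> sets E2 \<Longrightarrow> C \<in> sets (generated_sigma P E2 (\<lambda>k \<omega>. (X k \<omega>, Y k \<omega>)) {..n - 1}) \<Longrightarrow>
      measure P {\<omega>\<in>C. (X n \<omega>, Y n \<omega>) \<in> A} =
        (measure P {\<omega>\<in>C. (f_step h n 1 (X (n - 1) \<omega>), f_step h n 1 (Y (n - 1) \<omega>)) \<in> A} +
         measure P {\<omega>\<in>C. (f_step h n (-1) (X (n - 1) \<omega>), f_step h n (-1) (Y (n - 1) \<omega>)) \<in> A}) / 2"
  shows "markov_chain h P X Y"
  unfolding markov_chain_def
proof (intro conjI allI ballI)
  fix n A assume A: "A \<in> sets E2"
  interpret prob_space P by fact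
  let ?F = "generated_sigma P E2 (\<lambda>k \<omega>. (X k \<omega>, Y k \<omega>)) {..n - 1}"
  have XY: "(\<lambda>\<omega>. (X k \<omega>, Y k \<omega>)) \<in> P \<rightarrow>\<^sub>M E2" for k
    using X Y by (rule measurable_Pair)
  have sub: "subalgebra P ?F" by (rule subalgebra_generated_sigma[OF XY])
  interpret sigma_finite_subalgebra P ?F
    by (intro finite_measure_subalgebra_is_sigma_finite finite_measure_subalgebra.intro
        finite_measure_subalgebra_axioms.intro sub) unfold_locales
  have prev: "(\<lambda>\<omega>. (X (n - 1) \<omega>, Y (n - 1) \<omega>)) \<in> ?F \<rightarrow>\<^sub>M E2"
    using measurable_space[OF XY] by (intro measurable_generated_sigma) auto
  let ?s = "\<lambda>\<alpha> \<omega>. (f_step h n \<alpha> (X (n - 1) \<omega>), f_step h n \<alpha> (Y (n - 1) \<omega>))"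
  have s: "?s \<alpha> \<in> ?F \<rightarrow>\<^sub>M E2" if "\<alpha> \<in> {-1, 1}" for \<alpha>
    using measurable_compose[OF measurable_compose[OF prev measurable_fst] measurable_f_step[of h n, OF h that]]
      measurable_compose[OF measurable_compose[OF prev measurable_snd] measurable_f_step[of h n, OF h that]]
    by (intro measurable_Pair) simp_all
  let ?f = "\<lambda>\<omega>. indicator A (X n \<omega>, Y n \<omega>) :: real"
  let ?g = "\<lambda>\<omega>. (indicator A (?s 1 \<omega>) + indicator A (?s (-1) \<omega>)) / 2 :: real"
  have ind: "(\<lambda>\<omega>. indicator A (u \<omega>) :: real) \<in> borel_measurable N" if "u \<in> N \<rightarrow>\<^sub>M E2" for u and N :: "'b measure"
    using A by (intro measurable_compose[OF that]) simp
  have ind_int: "integrable P (\<lambda>\<omega>. indicator A (u \<omega>) :: real)" if "u \<in> P \<rightarrow>\<^sub>M E2" for u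
    by (rule integrable_const_bound[where B = 1, OF _ ind[OF that]]) simp
  have set_int: "(\<integral>\<omega>\<in>C. (indicator A (u \<omega>) :: real) \<partial>P) = measure P {\<omega>\<in>C. u \<omega> \<in> A}"
    if u: "u \<in> P \<rightarrow>\<^sub>M E2" and C: "C \<in> sets P" for u C
  proof -
    have eq: "{\<omega>\<in>C. u \<omega> \<in> A} = C \<inter> (u -` A \<inter> space P)"
      using sets.sets_into_space[OF C] by auto
    have "{\<omega>\<in>C. u \<omega> \<in> A} \<in> sets P"
      unfolding eq using C measurable_sets[OF u A] by auto
    moreover have "(\<integral>\<omega>\<in>C. (indicator A (u \<omega>) :: real) \<partial>P) = (\<integral>\<omega>. indicator {\<omega>\<in>C. u \<omega> \<in> A} \<omega> \<partial>P)"
      unfolding set_lebesgue_integral_def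
      by (intro Bochner_Integration.integral_cong) (auto split: split_indicator)
    ultimately show ?thesis by simp
  qed
  have sP: "?s \<alpha> \<in> P \<rightarrow>\<^sub>M E2" if "\<alpha> \<in> {-1, 1}" for \<alpha>
    by (rule measurable_from_subalg[OF sub s[OF that]])
  have "AE \<omega> in P. real_cond_exp P ?F ?f \<omega> = ?g \<omega>"
  proof (rule real_cond_exp_charact)
    show "integrable P ?f" by (rule ind_int[OF XY])
    show "integrable P ?g"
      by (intro integrable_divide_zero Bochner_Integration.integrable_add ind_int sP) auto
    show "?g \<in> borel_measurable ?F"
      by (intro borel_measurable_divide borel_measurable_add ind s borel_measurable_const) auto
    fix C assume C: "C \<in> sets ?F"
    then have CP: "C \<in> sets P" using sub by (auto simp: subalgebra_def)
    have si: "set_integrable P C (\<lambda>\<omega>. indicator A (?s \<alpha> \<omega>) :: real)" if "\<alpha> \<in> {-1, 1}" for \<alpha>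
      unfolding set_integrable_def by (rule integrable_mult_indicator[OF CP ind_int[OF sP[OF that]]])
    have "(\<integral>\<omega>\<in>C. ?f \<omega> \<partial>P) = ((\<integral>\<omega>\<in>C. indicator A (?s 1 \<omega>) \<partial>P) + (\<integral>\<omega>\<in>C. indicator A (?s (-1) \<omega>) \<partial>P)) / 2"
      using step[OF A C] set_int[OF XY CP] set_int[OF sP CP, of 1] set_int[OF sP CP, of "-1"] by simp
    also have "\<dots> = (\<integral>\<omega>\<in>C. ?g \<omega> \<partial>P)"
      using set_integral_add(2)[OF si[of 1] si[of "-1"]] by (simp add: set_integral_divide_zero)
    finally show "(\<integral>\<omega>\<in>C. ?f \<omega> \<partial>P) = (\<integral>\<omega>\<in>C. ?g \<omega> \<partial>P)" .
  qed
  then show "AE \<omega> in P. real_cond_exp P ?F ?f \<omega> = measure (pair_kernel h n (X (n - 1) \<omega>, Y (n - 1) \<omega>)) A"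
    by (simp add: measure_pair_kernel[OF A])
qed (use assms in auto)

section \<open>Extending a symmetric bimeasure\<close>

text \<open>
  The prescribed values are real because the extension theorem below works with a Polish
  space of values.
\<close>

definition cylinder :: "int set \<Rightarrow> (int \<Rightarrow> real) \<Rightarrow> (int \<Rightarrow> int) set" where
  "cylinder J c = {z \<in> space sign_sequences. \<forall>k\<in>J. real_of_int (z k) = c k}"

lemma sets_sign_sequences_component:
  "{z \<in> space sign_sequences. P (z k)} \<in> sets sign_sequences"
proof -
  have "(\<lambda>z. z k) -` {s\<in>{-1, 1}. P s} \<inter> space sign_sequences \<in> sets sign_sequences"
    by (rule measurable_sets[OF measurable_component_singleton]) auto
  also have "(\<lambda>z. z k) -` {s\<in>{-1, 1}. P s} \<inter> space sign_sequences = {z \<in> space sign_sequences. P (z k)}"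
    by (auto simp: space_PiM)
  finally show ?thesis .
qed

lemma sets_cylinder: "finite J \<Longrightarrow> cylinder J c \<in> sets sign_sequences"
  unfolding cylinder_def by (intro sets.sets_Collect_finite_All sets_sign_sequences_component)

lemma cylinder_insert:
  "cylinder (insert i J) c = cylinder J c \<inter> {z \<in> space sign_sequences. real_of_int (z i) = c i}"
  by (auto simp: cylinder_def)

lemma cylinder_cong: "(\<And>k. k \<in> J \<Longrightarrow> c k = c' k) \<Longrightarrow> cylinder J c = cylinder J c'"
  by (auto simp: cylinder_def)

text \<open>
  The alphabet is finite, so a cylinder over a product of sets of signs is a finite disjoint
  union of cylinders over single words.
\<close>

lemma measure_eqI_cylinder:
  assumes sets: "sets \<mu> = sets sign_sequences" "sets \<nu> = sets sign_sequences"
    and fin: "finite_measure \<mu>"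
    and eq: "\<And>J c. finite J \<Longrightarrow> c \<in> J \<rightarrow> {-1, 1} \<Longrightarrow> emeasure \<mu> (cylinder J c) = emeasure \<nu> (cylinder J c)"
  shows "\<mu> = \<nu>"
proof (rule measure_eqI_PiM_infinite[OF sets _ fin])
  fix A :: "int \<Rightarrow> int set" and J :: "int set"
  assume J: "finite J" "J \<subseteq> UNIV" and "\<And>i. i \<in> J \<Longrightarrow> A i \<in> sets signs"
  then have A: "\<And>i. i \<in> J \<Longrightarrow> A i \<subseteq> {-1, 1}" by auto
  let ?I = "Pi\<^sub>E J A" and ?c = "\<lambda>a k. real_of_int (a k)"
  have fin_I: "finite ?I"
    using J A by (intro finite_PiE) (auto intro: finite_subset)
  have emb: "prod_emb UNIV (\<lambda>_. signs) J ?I = (\<Union>a\<in>?I. cylinder J (?c a))"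
  proof (intro set_eqI iffI)
    fix z assume "z \<in> prod_emb UNIV (\<lambda>_. signs) J ?I"
    then show "z \<in> (\<Union>a\<in>?I. cylinder J (?c a))"
      by (auto simp: prod_emb_def cylinder_def space_PiM intro!: bexI[of _ "restrict z J"])
  next
    fix z assume "z \<in> (\<Union>a\<in>?I. cylinder J (?c a))"
    then obtain a where a: "a \<in> ?I" "z \<in> space sign_sequences" "\<forall>k\<in>J. z k = a k"
      by (auto simp: cylinder_def)
    then have "restrict z J = a"
      by (auto simp: PiE_iff extensional_def restrict_def)
    then show "z \<in> prod_emb UNIV (\<lambda>_. signs) J ?I"
      using a by (auto simp: prod_emb_def space_PiM)
  qed
  have disj: "disjoint_family_on (\<lambda>a. cylinder J (?c a)) ?I"
  unfolding disjoint_family_on_def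
  proof (intro ballI impI set_eqI iffI)
    fix a b z assume ab: "a \<in> ?I" "b \<in> ?I" "a \<noteq> b" and "z \<in> cylinder J (?c a) \<inter> cylinder J (?c b)"
    then have "\<forall>k\<in>J. a k = b k" by (auto simp: cylinder_def)
    then have "a = b" using ab by (intro PiE_ext) auto
    then show "z \<in> {}" using ab by simp
  qed simp
  have "emeasure \<kappa> (prod_emb UNIV (\<lambda>_. signs) J ?I) = (\<Sum>a\<in>?I. emeasure \<kappa> (cylinder J (?c a)))"
    if "sets \<kappa> = sets sign_sequences" for \<kappa>
    unfolding emb using sets_cylinder[OF J(1)] disj fin_I that by (intro sum_emeasure[symmetric]) auto
  moreover have "emeasure \<mu> (cylinder J (?c a)) = emeasure \<nu> (cylinder J (?c a))" if "a \<in> ?I" for a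
    using A that by (intro eq J) (fastforce simp: PiE_iff)
  ultimately show "emeasure \<mu> (prod_emb UNIV (\<lambda>_. signs) J ?I) = emeasure \<nu> (prod_emb UNIV (\<lambda>_. signs) J ?I)"
    using sets by simp
qed

lemma emeasure_distr_restricted:
  assumes f: "f \<in> M \<rightarrow>\<^sub>M N" and R: "R \<in> sets M" and A: "A \<in> sets N"
  shows "emeasure (distr (density M (indicator R)) N f) A = emeasure M (R \<inter> (f -` A \<inter> space M))"
proof -
  have "emeasure (distr (density M (indicator R)) N f) A = emeasure (density M (indicator R)) (f -` A \<inter> space M)"
    using f A by (subst emeasure_distr) auto
  then show ?thesis
    using emeasure_restricted[OF R measurable_sets[OF f A]] by simp
qed

text \<open>
  A symmetric function of pairs of measurable sets that is a measure in each argument, presented as the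
  family of its sections \<open>\<mu> B\<close>. Such a function is additive on rectangles only; that it
  extends to a measure on the product is a compactness phenomenon, supplied here by the Daniell-Kolmogorov
  theorem.
\<close>

locale symmetric_bimeasure =
  fixes \<mu> :: "(int \<Rightarrow> int) set \<Rightarrow> (int \<Rightarrow> int) measure"
  assumes sets_\<mu>: "\<And>B. B \<in> sets sign_sequences \<Longrightarrow> sets (\<mu> B) = sets sign_sequences"
    and symmetric: "\<And>A B. A \<in> sets sign_sequences \<Longrightarrow> B \<in> sets sign_sequences \<Longrightarrow>
      emeasure (\<mu> B) A = emeasure (\<mu> A) B"
    and normalized: "emeasure (\<mu> (space sign_sequences)) (space sign_sequences) = 1"
begin

lemma sum_over_sign:
  assumes A: "A \<in> sets sign_sequences" and B: "B \<in> sets sign_sequences"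
  shows "emeasure (\<mu> B) A =
    (\<Sum>r\<in>{-1, 1::real}. emeasure (\<mu> B) (A \<inter> {z \<in> space sign_sequences. real_of_int (z i) = r}))"
proof -
  let ?Z = "\<lambda>r::real. {z \<in> space sign_sequences. real_of_int (z i) = r}"
  have AZ: "A \<inter> ?Z r \<in> sets (\<mu> B)" for r
    using A sets_sign_sequences_component[of "\<lambda>s. real_of_int s = r" i] sets_\<mu>[OF B] by auto
  have "A = (A \<inter> ?Z (-1)) \<union> (A \<inter> ?Z 1)"
  proof -
    have "real_of_int (z i) = -1 \<or> real_of_int (z i) = 1" if "z \<in> space sign_sequences" for z
      using that by (auto simp: space_PiM PiE_iff dest: spec[of _ i])
    then show ?thesis
      using sets.sets_into_space[OF A] by blast
  qed
  then have "emeasure (\<mu> B) A = emeasure (\<mu> B) ((A \<inter> ?Z (-1)) \<union> (A \<inter> ?Z 1))" by simp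
  also have "\<dots> = emeasure (\<mu> B) (A \<inter> ?Z (-1)) + emeasure (\<mu> B) (A \<inter> ?Z 1)"
    by (intro plus_emeasure[symmetric] AZ) auto
  finally show ?thesis by simp
qed

text \<open>
  The mass of a pair of words. A pair of sign sequences is regarded as one family with index
  set \<open>bool \<times> int\<close>; the index \<open>True\<close> marks the first sequence and \<open>False\<close> the second. A finite
  set of indices can then contain different times of the two sequences.
\<close>

definition weight :: "(bool \<times> int) set \<Rightarrow> (bool \<times> int \<Rightarrow> real) \<Rightarrow> ennreal" where
  "weight J c = emeasure (\<mu> (cylinder {k. (False, k) \<in> J} (\<lambda>k. c (False, k))))
    (cylinder {k. (True, k) \<in> J} (\<lambda>k. c (True, k)))"

text \<open>
  Consistency of the finite-dimensional weights. A new index constrains one of the two sequences;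
  symmetry allows the sum to be taken in whichever argument that is.
\<close>

lemma weight_insert:
  assumes J: "finite J" and i: "i \<notin> J"
  shows "(\<Sum>r\<in>{-1, 1}. weight (insert i J) (c(i := r))) = weight J c"
proof -
  obtain s k where i_eq: "i = (s, k)" by (cases i)
  let ?J = "\<lambda>b. {k. (b, k) \<in> J}" and ?C = "\<lambda>b. cylinder {k. (b, k) \<in> J} (\<lambda>k. c (b, k))"
  have "?J b = snd ` {p\<in>J. fst p = b}" for b by force
  then have fin: "finite (?J b)" for b using J by simp
  have C: "?C b \<in> sets sign_sequences" for b by (rule sets_cylinder[OF fin])
  have ins: "{j. (s, j) \<in> insert i J} = insert k (?J s)" and other: "{j. (\<not> s, j) \<in> insert i J} = ?J (\<not> s)"
    using i_eq by auto
  have k: "k \<notin> ?J s" using i i_eq by simp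
  have C_s: "cylinder {j. (s, j) \<in> insert i J} (\<lambda>j. (c(i := r)) (s, j)) =
      ?C s \<inter> {z \<in> space sign_sequences. real_of_int (z k) = r}" for r
    unfolding ins cylinder_insert using k i_eq
    by (intro arg_cong2[where f = "(\<inter>)"] cylinder_cong) auto
  have C_not: "cylinder {j. (\<not> s, j) \<in> insert i J} (\<lambda>j. (c(i := r)) (\<not> s, j)) = ?C (\<not> s)" for r
    unfolding other using i_eq by (intro cylinder_cong) auto
  have Z: "?C s \<inter> {z \<in> space sign_sequences. real_of_int (z k) = r} \<in> sets sign_sequences" for r
    by (intro sets.Int C sets_sign_sequences_component)
  show ?thesis
  proof (cases s)
    case True
    have "weight (insert i J) (c(i := r)) =
        emeasure (\<mu> (?C False)) (?C True \<inter> {z \<in> space sign_sequences. real_of_int (z k) = r})" for r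
      using C_s[of r] C_not[of r] True unfolding weight_def by simp
    then show ?thesis
      unfolding weight_def[of J] sum_over_sign[OF C[of True] C[of False], of k] by simp
  next
    case False
    have "weight (insert i J) (c(i := r)) =
        emeasure (\<mu> (?C False \<inter> {z \<in> space sign_sequences. real_of_int (z k) = r})) (?C True)" for r
      using C_s[of r] C_not[of r] False unfolding weight_def by simp
    also have "\<dots> r = emeasure (\<mu> (?C True)) (?C False \<inter> {z \<in> space sign_sequences. real_of_int (z k) = r})" for r
      using Z[of r] False by (intro symmetric C) simp
    finally show ?thesis
      unfolding weight_def[of J] symmetric[OF C[of True] C[of False]] sum_over_sign[OF C[of False] C[of True], of k] by simp
  qed
qed

definition marginal :: "(bool \<times> int) set \<Rightarrow> (bool \<times> int \<Rightarrow> real) measure" where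
  "marginal J = distr (point_measure (J \<rightarrow>\<^sub>E {-1, 1}) (weight J)) (PiM J (\<lambda>_. borel)) (\<lambda>c. c)"

lemma sets_marginal: "sets (marginal J) = sets (PiM J (\<lambda>_. borel))"
  by (simp add: marginal_def)

lemma space_marginal: "space (marginal J) = space (PiM J (\<lambda>_. borel))"
  by (simp add: marginal_def)

lemma emeasure_marginal:
  assumes J: "finite J" and X: "X \<in> sets (PiM J (\<lambda>_. borel))"
  shows "emeasure (marginal J) X = (\<Sum>c\<in>J \<rightarrow>\<^sub>E {-1, 1}. weight J c * indicator X c)"
proof -
  have fin: "finite (J \<rightarrow>\<^sub>E {-1, 1::real})" using J by (intro finite_PiE) auto
  have "(\<lambda>c. c) \<in> point_measure (J \<rightarrow>\<^sub>E {-1, 1}) (weight J) \<rightarrow>\<^sub>M PiM J (\<lambda>_. borel)"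
    by (rule measurableI) (auto simp: space_PiM space_point_measure sets_point_measure PiE_iff)
  then have "emeasure (marginal J) X = emeasure (point_measure (J \<rightarrow>\<^sub>E {-1, 1}) (weight J)) (X \<inter> (J \<rightarrow>\<^sub>E {-1, 1}))"
    using X by (simp add: marginal_def emeasure_distr space_point_measure)
  also have "\<dots> = (\<Sum>c\<in>X \<inter> (J \<rightarrow>\<^sub>E {-1, 1}). weight J c)"
    using fin by (intro emeasure_point_measure_finite) auto
  also have "\<dots> = (\<Sum>c\<in>J \<rightarrow>\<^sub>E {-1, 1}. weight J c * indicator X c)"
    using fin by (intro sum.mono_neutral_cong_left) (auto simp: indicator_def)
  finally show ?thesis .
qed

lemma marginal_insert:
  assumes J: "finite J" and i: "i \<notin> J"
  shows "distr (marginal (insert i J)) (PiM J (\<lambda>_. borel)) (\<lambda>f. restrict f J) = marginal J"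
proof (rule measure_eqI)
  fix X assume "X \<in> sets (distr (marginal (insert i J)) (PiM J (\<lambda>_. borel)) (\<lambda>f. restrict f J))"
  then have X: "X \<in> sets (PiM J (\<lambda>_. borel))" by simp
  let ?W = "{-1, 1::real}"
  have r: "(\<lambda>f. restrict f J) \<in> marginal (insert i J) \<rightarrow>\<^sub>M PiM J (\<lambda>_. borel)"
    unfolding measurable_cong_sets[OF sets_marginal refl] by (rule measurable_restrict_subset) auto
  let ?Y = "(\<lambda>f. restrict f J) -` X \<inter> space (PiM (insert i J) (\<lambda>_. borel))"
  have Y: "?Y \<in> sets (PiM (insert i J) (\<lambda>_. borel))"
    using measurable_sets[OF r X] by (simp add: sets_marginal space_marginal)
  have "emeasure (distr (marginal (insert i J)) (PiM J (\<lambda>_. borel)) (\<lambda>f. restrict f J)) X = emeasure (marginal (insert i J)) ?Y"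
    using r X by (simp add: emeasure_distr space_marginal)
  also have "\<dots> = (\<Sum>c\<in>insert i J \<rightarrow>\<^sub>E ?W. weight (insert i J) c * indicator ?Y c)"
    using J by (intro emeasure_marginal Y) simp
  also have "\<dots> = (\<Sum>c\<in>insert i J \<rightarrow>\<^sub>E ?W. weight (insert i J) c * indicator X (restrict c J))"
    by (intro sum.cong) (auto simp: space_PiM indicator_def)
  also have "\<dots> = (\<Sum>(r, d)\<in>?W \<times> (J \<rightarrow>\<^sub>E ?W). weight (insert i J) (d(i := r)) * indicator X (restrict (d(i := r)) J))"
    unfolding PiE_insert_eq using inj_combinator[OF i, of "\<lambda>_. ?W"]
    by (subst sum.reindex) (auto intro!: sum.cong)
  also have "\<dots> = (\<Sum>r\<in>?W. \<Sum>d\<in>J \<rightarrow>\<^sub>E ?W. weight (insert i J) (d(i := r)) * indicator X (restrict (d(i := r)) J))"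
    by (rule sum.cartesian_product[symmetric])
  also have "\<dots> = (\<Sum>d\<in>J \<rightarrow>\<^sub>E ?W. \<Sum>r\<in>?W. weight (insert i J) (d(i := r)) * indicator X (restrict (d(i := r)) J))"
    by (rule sum.swap)
  also have "\<dots> = (\<Sum>d\<in>J \<rightarrow>\<^sub>E ?W. (\<Sum>r\<in>?W. weight (insert i J) (d(i := r))) * indicator X d)"
    unfolding sum_distrib_right
  proof (intro sum.cong refl)
    fix d r assume "d \<in> J \<rightarrow>\<^sub>E ?W"
    then have "restrict (d(i := r)) J = d"
      using i by (auto simp: restrict_def PiE_iff extensional_def)
    then show "weight (insert i J) (d(i := r)) * indicator X (restrict (d(i := r)) J) = weight (insert i J) (d(i := r)) * indicator X d"
      by simp
  qed
  also have "\<dots> = emeasure (marginal J) X"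
    unfolding weight_insert[OF J i] by (rule emeasure_marginal[OF J X, symmetric])
  finally show "emeasure (distr (marginal (insert i J)) (PiM J (\<lambda>_. borel)) (\<lambda>f. restrict f J)) X = emeasure (marginal J) X" .
qed (simp add: sets_marginal)

lemma marginal_restrict:
  assumes "finite D" "finite J" "J \<inter> D = {}"
  shows "marginal J = distr (marginal (J \<union> D)) (PiM J (\<lambda>_. borel)) (\<lambda>f. restrict f J)"
  using assms
proof (induction D rule: finite_induct)
  case empty
  have "emeasure (distr (marginal J) (PiM J (\<lambda>_. borel)) (\<lambda>f. restrict f J)) X = emeasure (marginal J) X"
    if "X \<in> sets (PiM J (\<lambda>_. borel))" for X
  proof -
    have "(\<lambda>f. restrict f J) \<in> marginal J \<rightarrow>\<^sub>M PiM J (\<lambda>_. borel)"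
      unfolding measurable_cong_sets[OF sets_marginal refl] by (rule measurable_restrict_subset) auto
    moreover have "(\<lambda>f. restrict f J) -` X \<inter> space (marginal J) = X"
      using sets.sets_into_space[OF that] by (auto simp: space_marginal space_PiM)
    ultimately show ?thesis using that by (simp add: emeasure_distr)
  qed
  then have "distr (marginal J) (PiM J (\<lambda>_. borel)) (\<lambda>f. restrict f J) = marginal J"
    by (intro measure_eqI) (simp_all add: sets_marginal)
  then show ?case
    unfolding Un_empty_right by (rule sym)
next
  case (insert i D)
  have m: "(\<lambda>f. restrict f K) \<in> marginal L \<rightarrow>\<^sub>M PiM K (\<lambda>_. borel)" if "K \<subseteq> L" for K L
    unfolding measurable_cong_sets[OF sets_marginal refl] by (rule measurable_restrict_subset[OF that])
  have m': "(\<lambda>f. restrict f J) \<in> PiM (J \<union> D) (\<lambda>_. borel) \<rightarrow>\<^sub>M PiM J (\<lambda>_. borel)"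
    by (rule measurable_restrict_subset) auto
  have "marginal J = distr (marginal (J \<union> D)) (PiM J (\<lambda>_. borel)) (\<lambda>f. restrict f J)"
    by (rule insert.IH) (use insert.prems in auto)
  also have "marginal (J \<union> D) = distr (marginal (insert i (J \<union> D))) (PiM (J \<union> D) (\<lambda>_. borel)) (\<lambda>f. restrict f (J \<union> D))"
    using insert by (intro marginal_insert[symmetric]) auto
  also have "distr \<dots> (PiM J (\<lambda>_. borel)) (\<lambda>f. restrict f J) =
      distr (marginal (insert i (J \<union> D))) (PiM J (\<lambda>_. borel)) (\<lambda>f. restrict f J)"
    using m[of "J \<union> D" "insert i (J \<union> D)"] m'
    by (subst distr_distr) (auto simp: comp_def Int_absorb1 Int_commute intro!: distr_cong)
  finally show ?case by (simp only: Un_insert_right)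
qed

text \<open>
  Normalisation need only be checked for the empty set of indices, since restriction preserves
  the total mass.
\<close>

lemma marginals_projective: "polish_projective UNIV marginal"
proof (intro polish_projective.intro projective_family.intro)
  fix J H :: "(bool \<times> int) set" assume JH: "J \<subseteq> H" "finite H"
  then show "marginal J = distr (marginal H) (PiM J (\<lambda>_. borel)) (\<lambda>f. restrict f J)"
    using marginal_restrict[of "H - J" J] by (auto simp: Un_absorb1 dest: finite_subset)
next
  fix J :: "(bool \<times> int) set" assume J: "finite J"
  have r: "(\<lambda>f. restrict f {}) \<in> marginal J \<rightarrow>\<^sub>M PiM {} (\<lambda>_. borel)"
    unfolding measurable_cong_sets[OF sets_marginal refl] by (rule measurable_restrict_subset) auto
  have "emeasure (marginal J) (space (marginal J)) = emeasure (marginal {}) (space (marginal {}))"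
  proof -
    have "(\<lambda>f. restrict f {}) -` space (PiM {} (\<lambda>_. borel)) \<inter> space (marginal J) = space (marginal J)"
      using measurable_space[OF r] by blast
    moreover have "marginal {} = distr (marginal J) (PiM {} (\<lambda>_. borel)) (\<lambda>f. restrict f {})"
      using marginal_restrict[OF J, of "{}"] by simp
    ultimately show ?thesis
      using emeasure_distr[OF r sets.top] by (simp add: space_marginal)
  qed
  also have "\<dots> = weight {} (\<lambda>_. undefined)"
    using emeasure_marginal[OF finite.emptyI sets.top] by (simp add: space_marginal space_PiM)
  also have "\<dots> = 1"
    using normalized by (simp add: weight_def cylinder_def)
  finally show "prob_space (marginal J)" by (rule prob_spaceI)
qed

text \<open>
  The projective limit has the right mass on rectangles of cylinders by construction. With one
  side of the rectangle fixed, both sides of the equation are finite measures in the other, so the identity extends to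
  all rectangles, one side at a time.
\<close>

lemma coupling_exists:
  obtains Q where "sets Q = sets (sign_sequences \<Otimes>\<^sub>M sign_sequences)" "prob_space Q"
    "\<And>A B. A \<in> sets sign_sequences \<Longrightarrow> B \<in> sets sign_sequences \<Longrightarrow> emeasure Q (A \<times> B) = emeasure (\<mu> B) A"
proof -
  interpret PF: polish_projective UNIV marginal by (rule marginals_projective)
  let ?S = sign_sequences
  \<comment> \<open>Values other than \<open>1\<close> and \<open>-1\<close> have probability zero; rounding makes the coordinates signs everywhere.\<close>
  define sg :: "real \<Rightarrow> int" where "sg r = (if 0 < r then 1 else -1)" for r
  have sg_pm: "sg r = -1 \<or> sg r = 1" for r by (simp add: sg_def)
  define \<phi> where "\<phi> z = (\<lambda>k. sg (z (True, k)), \<lambda>k. sg (z (False, k)))" for z :: "bool \<times> int \<Rightarrow> real"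
  have sg: "sg \<in> borel \<rightarrow>\<^sub>M signs"
    unfolding sg_def by (intro measurable_If) auto
  have sets_lim: "sets PF.lim = sets (PiM UNIV (\<lambda>_. borel))" by simp
  have coord: "(\<lambda>z k. sg (z (b, k))) \<in> PF.lim \<rightarrow>\<^sub>M ?S" for b
    unfolding measurable_cong_sets[OF sets_lim refl]
    by (intro measurable_sequence measurable_compose[OF _ sg] measurable_component_singleton UNIV_I)
  have \<phi>: "\<phi> \<in> PF.lim \<rightarrow>\<^sub>M ?S \<Otimes>\<^sub>M ?S"
    unfolding \<phi>_def by (intro measurable_Pair coord)
  define Q where "Q = distr PF.lim (?S \<Otimes>\<^sub>M ?S) \<phi>"
  have sets_Q: "sets Q = sets (?S \<Otimes>\<^sub>M ?S)" by (simp add: Q_def)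
  interpret Q: prob_space Q unfolding Q_def by (rule PF.P.prob_space_distr[OF \<phi>])
  have cyl: "emeasure Q (cylinder J a \<times> cylinder K b) = emeasure (\<mu> (cylinder K b)) (cylinder J a)"
    if J: "finite J" "a \<in> J \<rightarrow> {-1, 1}" and K: "finite K" "b \<in> K \<rightarrow> {-1, 1}" for J K a b
  proof -
    let ?I = "{True} \<times> J \<union> {False} \<times> K"
    define c where "c p = (if fst p then a (snd p) else b (snd p))" for p :: "bool \<times> int"
    let ?X = "\<Pi>\<^sub>E p\<in>?I. if c p = 1 then {0<..} else {..0::real}"
    have fin: "finite ?I" using J K by auto
    have X: "?X \<in> sets (PiM ?I (\<lambda>_. borel))"
      using fin by (intro sets_PiM_I_finite) auto
    have c: "c p \<in> {-1, 1}" if "p \<in> ?I" for p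
      using that J(2) K(2) by (auto simp: c_def)
    \<comment> \<open>Rounding turns the event that a coordinate is a given sign into a half-line, which contains exactly one sign.\<close>
    have pre: "\<phi> -` (cylinder J a \<times> cylinder K b) \<inter> space PF.lim = prod_emb UNIV (\<lambda>_. borel) ?I ?X"
    proof -
      have sg_iff: "real_of_int (sg r) = v \<longleftrightarrow> r \<in> (if v = 1 then {0<..} else {..0})" if "v \<in> {-1, 1}" for r v
        using that by (auto simp: sg_def)
      have "\<phi> z \<in> cylinder J a \<times> cylinder K b \<longleftrightarrow> z \<in> prod_emb UNIV (\<lambda>_. borel) ?I ?X" for z
      proof -
        have "\<phi> z \<in> space ?S \<times> space ?S"
          using sg_pm by (simp add: \<phi>_def space_PiM PiE_iff)
        then have "\<phi> z \<in> cylinder J a \<times> cylinder K b \<longleftrightarrow>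
            (\<forall>k\<in>J. real_of_int (sg (z (True, k))) = a k) \<and> (\<forall>k\<in>K. real_of_int (sg (z (False, k))) = b k)"
          by (auto simp: \<phi>_def cylinder_def)
        also have "\<dots> \<longleftrightarrow> (\<forall>p\<in>?I. real_of_int (sg (z p)) = c p)"
          by (auto simp: c_def)
        also have "\<dots> \<longleftrightarrow> (\<forall>p\<in>?I. z p \<in> (if c p = 1 then {0<..} else {..0}))"
          using sg_iff[OF c] by (intro ball_cong refl)
        also have "\<dots> \<longleftrightarrow> z \<in> prod_emb UNIV (\<lambda>_. borel) ?I ?X"
          unfolding prod_emb_iff restrict_PiE_iff by simp
        finally show ?thesis .
      qed
      then have "\<phi> -` (cylinder J a \<times> cylinder K b) = prod_emb UNIV (\<lambda>_. borel) ?I ?X"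
        by (intro set_eqI) (simp only: vimage_eq)
      then show ?thesis by (simp add: space_PiM)
    qed
    have "cylinder J a \<times> cylinder K b \<in> sets (?S \<Otimes>\<^sub>M ?S)"
      using J K by (intro pair_measureI sets_cylinder) auto
    then have "emeasure Q (cylinder J a \<times> cylinder K b) = emeasure PF.lim (prod_emb UNIV (\<lambda>_. borel) ?I ?X)"
      unfolding Q_def using \<phi> by (simp only: emeasure_distr pre)
    also have "\<dots> = emeasure (marginal ?I) ?X"
      by (rule PF.emeasure_lim_emb[OF _ fin X]) simp
    also have "\<dots> = (\<Sum>d\<in>?I \<rightarrow>\<^sub>E {-1, 1}. weight ?I d * indicator ?X d)"
      by (rule emeasure_marginal[OF fin X])
    also have "\<dots> = (\<Sum>d\<in>?I \<rightarrow>\<^sub>E {-1, 1}. if d = restrict c ?I then weight ?I d else 0)"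
    proof (intro sum.cong refl)
      fix d assume d: "d \<in> ?I \<rightarrow>\<^sub>E {-1, 1::real}"
      have "d \<in> ?X \<longleftrightarrow> (\<forall>p\<in>?I. d p \<in> (if c p = 1 then {0<..} else {..0}))"
        using d unfolding PiE_iff by blast
      also have "\<dots> \<longleftrightarrow> (\<forall>p\<in>?I. d p = c p)"
      proof (intro ball_cong refl)
        fix p assume p: "p \<in> ?I"
        show "d p \<in> (if c p = 1 then {0<..} else {..0}) \<longleftrightarrow> d p = c p"
          using PiE_mem[OF d p] c[OF p] by auto
      qed
      also have "\<dots> \<longleftrightarrow> d = restrict c ?I"
      proof
        assume "\<forall>p\<in>?I. d p = c p"
        then have "restrict d ?I = restrict c ?I" by (intro restrict_ext) blast
        then show "d = restrict c ?I" using PiE_restrict[OF d] by simp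
      qed simp
      finally show "weight ?I d * indicator ?X d = (if d = restrict c ?I then weight ?I d else 0)"
        by (simp add: indicator_def)
    qed
    also have "\<dots> = weight ?I (restrict c ?I)"
      using c fin by (subst sum.delta) (auto intro!: finite_PiE)
    also have "\<dots> = emeasure (\<mu> (cylinder K b)) (cylinder J a)"
    proof -
      have "cylinder {k. (True, k) \<in> ?I} (\<lambda>k. restrict c ?I (True, k)) = cylinder J a"
          "cylinder {k. (False, k) \<in> ?I} (\<lambda>k. restrict c ?I (False, k)) = cylinder K b"
        by (auto simp: cylinder_def c_def)
      then show ?thesis by (simp add: weight_def)
    qed
    finally show ?thesis .
  qed
  have rect: "A \<times> B \<in> sets Q" if "A \<in> sets ?S" "B \<in> sets ?S" for A B
    using that by (simp add: sets_Q pair_measureI)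
  have fin_\<mu>: "finite_measure (\<mu> B)" if B: "B \<in> sets ?S" for B
  proof (rule finite_measureI)
    have top: "space ?S \<in> sets ?S" by auto
    have "emeasure (\<mu> B) (space (\<mu> B)) = emeasure (\<mu> (space ?S)) B"
      using symmetric[OF top B] sets_eq_imp_space_eq[OF sets_\<mu>[OF B]] by simp
    also have "\<dots> \<le> emeasure (\<mu> (space ?S)) (space ?S)"
      using B sets.sets_into_space[OF B] sets_\<mu>[OF top] by (intro emeasure_mono) auto
    finally show "emeasure (\<mu> B) (space (\<mu> B)) \<noteq> \<infinity>"
      using normalized by (auto simp: top_unique)
  qed
  have slice: "emeasure (distr (density Q (indicator (space ?S \<times> B))) ?S fst) A = emeasure Q (A \<times> B)"
    if A: "A \<in> sets ?S" and B: "B \<in> sets ?S" for A B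
  proof -
    have f: "fst \<in> Q \<rightarrow>\<^sub>M ?S" by (simp add: measurable_cong_sets[OF sets_Q refl])
    have sp: "space ?S \<times> B \<in> sets Q" using rect[OF sets.top B] .
    have "fst -` A \<inter> space Q \<in> sets Q" using f A by (rule measurable_sets)
    moreover have "(fst -` A \<inter> space Q) \<inter> (space ?S \<times> B) = A \<times> B"
      using sets.sets_into_space[OF A] sets.sets_into_space[OF B] sets_eq_imp_space_eq[OF sets_Q]
      by (auto simp: space_pair_measure)
    ultimately show ?thesis
      unfolding emeasure_distr_restricted[OF f sp A] by (simp only: Int_commute)
  qed
  have slice': "emeasure (distr (density Q (indicator (A \<times> space ?S))) ?S snd) B = emeasure Q (A \<times> B)"
    if A: "A \<in> sets ?S" and B: "B \<in> sets ?S" for A B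
  proof -
    have f: "snd \<in> Q \<rightarrow>\<^sub>M ?S" by (simp add: measurable_cong_sets[OF sets_Q refl])
    have sp: "A \<times> space ?S \<in> sets Q" using rect[OF A sets.top] .
    have "snd -` B \<inter> space Q \<in> sets Q" using f B by (rule measurable_sets)
    moreover have "(snd -` B \<inter> space Q) \<inter> (A \<times> space ?S) = A \<times> B"
      using sets.sets_into_space[OF A] sets.sets_into_space[OF B] sets_eq_imp_space_eq[OF sets_Q]
      by (auto simp: space_pair_measure)
    ultimately show ?thesis
      unfolding emeasure_distr_restricted[OF f sp B] by (simp only: Int_commute)
  qed
  \<comment> \<open>First the left side becomes arbitrary, then the right side.\<close>
  have half: "emeasure Q (A \<times> cylinder K b) = emeasure (\<mu> (cylinder K b)) A"
    if A: "A \<in> sets ?S" and K: "finite K" "b \<in> K \<rightarrow> {-1, 1}" for A K b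
  proof -
    note B = sets_cylinder[OF K(1), of b]
    have "\<mu> (cylinder K b) = distr (density Q (indicator (space ?S \<times> cylinder K b))) ?S fst"
      using cyl[OF _ _ K] slice[OF sets_cylinder B]
      by (intro measure_eqI_cylinder sets_\<mu> fin_\<mu> B) auto
    then show ?thesis using slice[OF A B] by simp
  qed
  have "emeasure Q (A \<times> B) = emeasure (\<mu> B) A" if A: "A \<in> sets ?S" and B: "B \<in> sets ?S" for A B
  proof -
    have "\<mu> A = distr (density Q (indicator (A \<times> space ?S))) ?S snd"
    proof (intro measure_eqI_cylinder sets_\<mu> fin_\<mu> A)
      fix K :: "int set" and b assume K: "finite K" "b \<in> K \<rightarrow> {-1, 1::real}"
      note B = sets_cylinder[OF K(1), of b]
      show "emeasure (\<mu> A) (cylinder K b) = emeasure (distr (density Q (indicator (A \<times> space ?S))) ?S snd) (cylinder K b)"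
        unfolding slice'[OF A B] half[OF A K] by (rule symmetric[OF B A])
    qed simp
    then show ?thesis using slice'[OF A B] symmetric[OF A B] by simp
  qed
  then show thesis
    using that[OF sets_Q Q.prob_space_axioms] by blast
qed

end

section \<open>Two conditionally independent copies\<close>

context sign_change begin

abbreviation cond :: "'a set \<Rightarrow> 'a \<Rightarrow> ennreal" where
  "cond B \<equiv> nn_cond_exp M \<eta>_field (indicator B)"

lemma nn_integral_cond_field:
  assumes "C \<in> sets \<eta>_field" "B \<in> sets M"
  shows "(\<integral>\<^sup>+\<omega>\<in>C. cond B \<omega> \<partial>M) = emeasure M (C \<inter> B)"
proof -
  interpret all: sigma_finite_subalgebra M \<eta>_field by (rule sigma_finite_\<eta>)
  have C: "C \<in> sets M" using assms(1) subalgebra_\<eta> by (auto simp: subalgebra_def)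
  have "(\<integral>\<^sup>+\<omega>\<in>C. cond B \<omega> \<partial>M) = (\<integral>\<^sup>+\<omega>. indicator C \<omega> * indicator B \<omega> \<partial>M)"
    using all.nn_cond_exp_intg[of "indicator C" "indicator B"] assms by (simp add: mult.commute)
  also have "\<dots> = (\<integral>\<^sup>+\<omega>. indicator (C \<inter> B) \<omega> \<partial>M)"
    by (intro nn_integral_cong) (simp split: split_indicator)
  also have "\<dots> = emeasure M (C \<inter> B)"
    using C assms(2) by simp
  finally show ?thesis .
qed

text \<open>
  Both sides are the integral of \<open>P(A | \<eta>) P(B | \<eta>)\<close>.
\<close>

lemma nn_integral_cond_symmetric:
  assumes "A \<in> sets M" "B \<in> sets M"
  shows "(\<integral>\<^sup>+\<omega>\<in>A. cond B \<omega> \<partial>M) = (\<integral>\<^sup>+\<omega>\<in>B. cond A \<omega> \<partial>M)"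
proof -
  interpret all: sigma_finite_subalgebra M \<eta>_field by (rule sigma_finite_\<eta>)
  have "(\<integral>\<^sup>+\<omega>. cond B \<omega> * cond A \<omega> \<partial>M) = (\<integral>\<^sup>+\<omega>\<in>A. cond B \<omega> \<partial>M)"
    if "A \<in> sets M" for A B
    using that by (intro all.nn_cond_exp_intg) auto
  from this[OF assms(1), of B] this[OF assms(2), of A] show ?thesis
    by (simp add: mult.commute)
qed

text \<open>
  By \<open>nn_cond_exp_\<eta>_field\<close> the conditional probability of \<open>B\<close> may be replaced by a function of \<open>\<eta>\<close>
  before \<open>n\<close>, and \<open>\<eta> n\<close> is fair given \<open>\<epsilon>\<close> before \<open>n\<close>.
\<close>

lemma nn_integral_cond_fair:
  assumes A: "A \<in> sets (\<epsilon>_before n)" and B: "B \<in> sets (\<epsilon>_before n)" and s: "s \<in> {-1, 1}"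
  shows "(\<integral>\<^sup>+\<omega>\<in>A \<inter> \<eta> n -` {s}. cond B \<omega> \<partial>M) = (\<integral>\<^sup>+\<omega>\<in>A. cond B \<omega> \<partial>M) / 2"
proof -
  let ?g = "nn_cond_exp M (\<eta>_before n) (indicator B)"
  have g: "?g \<in> borel_measurable (\<epsilon>_before n)"
    by (rule measurable_finer[OF borel_measurable_nn_cond_exp]) (use \<eta>_before_subset_\<epsilon>_before in auto)
  have f: "(\<lambda>\<omega>. ?g \<omega> * indicator A \<omega>) \<in> borel_measurable (\<epsilon>_before n)"
    using g A by (intro borel_measurable_times_ennreal) auto
  have "(\<integral>\<^sup>+\<omega>\<in>A \<inter> \<eta> n -` {s}. cond B \<omega> \<partial>M) = (\<integral>\<^sup>+\<omega>. ?g \<omega> * indicator A \<omega> * indicator {s} (\<eta> n \<omega>) \<partial>M)"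
  proof (rule nn_integral_cong_AE)
    show "AE \<omega> in M. cond B \<omega> * indicator (A \<inter> \<eta> n -` {s}) \<omega> = ?g \<omega> * indicator A \<omega> * indicator {s} (\<eta> n \<omega>)"
      using nn_cond_exp_\<eta>_field[OF B] by eventually_elim (simp split: split_indicator)
  qed
  also have "\<dots> = (\<integral>\<^sup>+\<omega>. ?g \<omega> * indicator A \<omega> \<partial>M) / 2"
    by (rule fair_given_nn_integral_singleton[OF fair_\<eta> s f])
  also have "(\<integral>\<^sup>+\<omega>. ?g \<omega> * indicator A \<omega> \<partial>M) = (\<integral>\<^sup>+\<omega>\<in>A. cond B \<omega> \<partial>M)"
  proof (rule nn_integral_cong_AE)
    show "AE \<omega> in M. ?g \<omega> * indicator A \<omega> = cond B \<omega> * indicator A \<omega>"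
      using nn_cond_exp_\<eta>_field[OF B] by eventually_elim simp
  qed
  finally show ?thesis .
qed

abbreviation \<epsilon>_seq :: "'a \<Rightarrow> int \<Rightarrow> int" where
  "\<epsilon>_seq \<omega> \<equiv> \<lambda>k. \<epsilon> k \<omega>"

abbreviation pull :: "(int \<Rightarrow> int) set \<Rightarrow> 'a set" where
  "pull A \<equiv> \<epsilon>_seq -` A \<inter> space M"

lemma \<epsilon>_seq_measurable: "\<epsilon>_seq \<in> M \<rightarrow>\<^sub>M sign_sequences"
  by (rule measurable_sequence[OF \<epsilon>_measurable])

lemma sets_pull: "A \<in> sets sign_sequences \<Longrightarrow> pull A \<in> sets M"
  by (rule measurable_sets[OF \<epsilon>_seq_measurable])

text \<open>
  \<open>Q\<close> is the law of two copies of \<open>\<epsilon>\<close> that are conditionally independent given \<open>\<eta>\<close>. The conditional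
  probabilities form a bimeasure without the choice of a regular conditional distribution.
\<close>

lemma conditionally_independent_copies:
  obtains Q where "sets Q = sets (sign_sequences \<Otimes>\<^sub>M sign_sequences)" "prob_space Q"
    "\<And>A B. A \<in> sets sign_sequences \<Longrightarrow> B \<in> sets sign_sequences \<Longrightarrow>
      emeasure Q (A \<times> B) = (\<integral>\<^sup>+\<omega>\<in>pull A. cond (pull B) \<omega> \<partial>M)"
proof -
  let ?\<mu> = "\<lambda>B. distr (density M (cond (pull B))) sign_sequences \<epsilon>_seq"
  have \<mu>: "emeasure (?\<mu> B) A = (\<integral>\<^sup>+\<omega>\<in>pull A. cond (pull B) \<omega> \<partial>M)" if A: "A \<in> sets sign_sequences" for A B
    using \<epsilon>_seq_measurable sets_pull[OF A] A by (simp add: emeasure_distr emeasure_density)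
  interpret symmetric_bimeasure ?\<mu>
  proof
    show "emeasure (?\<mu> B) A = emeasure (?\<mu> A) B"
      if "A \<in> sets sign_sequences" "B \<in> sets sign_sequences" for A B
      using that by (simp add: \<mu> nn_integral_cond_symmetric sets_pull)
    have "pull (space sign_sequences) = space M"
      using measurable_space[OF \<epsilon>_seq_measurable] by auto
    then show "emeasure (?\<mu> (space sign_sequences)) (space sign_sequences) = 1"
      using nn_integral_cond_field[of "space M" "space M"] sets.top[of \<eta>_field] emeasure_space_1
      unfolding \<mu>[OF sets.top] by simp
  qed simp
  obtain Q where Q: "sets Q = sets (sign_sequences \<Otimes>\<^sub>M sign_sequences)" "prob_space Q"
    "\<And>A B. A \<in> sets sign_sequences \<Longrightarrow> B \<in> sets sign_sequences \<Longrightarrow> emeasure Q (A \<times> B) = emeasure (?\<mu> B) A"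
    by (rule coupling_exists) blast
  show thesis
  proof (rule that[OF Q(1,2)])
    fix A B assume AB: "A \<in> sets sign_sequences" "B \<in> sets sign_sequences"
    show "emeasure Q (A \<times> B) = (\<integral>\<^sup>+\<omega>\<in>pull A. cond (pull B) \<omega> \<partial>M)"
      unfolding Q(3)[OF AB] by (rule \<mu>[OF AB(1)])
  qed
qed

end

abbreviation coordinates_before :: "int \<Rightarrow> (int \<Rightarrow> int) measure" where
  "coordinates_before n \<equiv> generated_sigma sign_sequences signs (\<lambda>k z. z k) {..<n}"

lemma coordinates_before_component: "k < n \<Longrightarrow> (\<lambda>z. z k) \<in> coordinates_before n \<rightarrow>\<^sub>M signs"
  by (intro measurable_generated_sigma) (auto simp: space_PiM)

lemma coordinates_before_subset: "sets (coordinates_before n) \<subseteq> sets sign_sequences"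
  by (intro sets_generated_sigma_subset measurable_component_singleton) auto

text \<open>
  The law \<open>Q\<close> of \<open>conditionally_independent_copies\<close>, together with the noises \<open>u\<close> and \<open>v\<close>
  of the first and of the second copy.
\<close>

locale relative_coupling = sign_change M \<epsilon> h + Q: prob_space Q
  for M :: "'a measure" and \<epsilon> h and Q :: "((int \<Rightarrow> int) \<times> (int \<Rightarrow> int)) measure" +
  assumes sets_Q: "sets Q = sets (sign_sequences \<Otimes>\<^sub>M sign_sequences)"
    and emeasure_Q: "\<And>A B. A \<in> sets sign_sequences \<Longrightarrow> B \<in> sets sign_sequences \<Longrightarrow>
      emeasure Q (A \<times> B) = (\<integral>\<^sup>+\<omega>\<in>pull A. cond (pull B) \<omega> \<partial>M)"
begin

abbreviation u :: "int \<Rightarrow> (int \<Rightarrow> int) \<times> (int \<Rightarrow> int) \<Rightarrow> int" where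
  "u n \<omega> \<equiv> innovation h (fst \<omega>) n"

abbreviation v :: "int \<Rightarrow> (int \<Rightarrow> int) \<times> (int \<Rightarrow> int) \<Rightarrow> int" where
  "v n \<omega> \<equiv> innovation h (snd \<omega>) n"

abbreviation pair_before :: "int \<Rightarrow> ((int \<Rightarrow> int) \<times> (int \<Rightarrow> int)) measure" where
  "pair_before n \<equiv> coordinates_before n \<Otimes>\<^sub>M coordinates_before n"

lemma space_Q: "space Q = space sign_sequences \<times> space sign_sequences"
  using sets_eq_imp_space_eq[OF sets_Q] by (simp add: space_pair_measure)

lemma rectangle_Q: "A \<in> sets sign_sequences \<Longrightarrow> B \<in> sets sign_sequences \<Longrightarrow> A \<times> B \<in> sets Q"
  by (simp add: sets_Q pair_measureI)

lemma component_measurable: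
  shows "(\<lambda>\<omega>. fst \<omega> k) \<in> Q \<rightarrow>\<^sub>M signs" and "(\<lambda>\<omega>. snd \<omega> k) \<in> Q \<rightarrow>\<^sub>M signs"
  unfolding measurable_cong_sets[OF sets_Q refl]
  by (rule measurable_compose[OF measurable_fst measurable_component_singleton], simp)
    (rule measurable_compose[OF measurable_snd measurable_component_singleton], simp)

lemma past_measurable:
  shows "(\<lambda>\<omega>. past (fst \<omega>) n) \<in> Q \<rightarrow>\<^sub>M E"
    and "(\<lambda>\<omega>. past (snd \<omega>) n) \<in> Q \<rightarrow>\<^sub>M E"
  using measurable_past[of n "\<lambda>k \<omega>. fst \<omega> k" Q] measurable_past[of n "\<lambda>k \<omega>. snd \<omega> k" Q] component_measurable
  by simp_all

lemma innovation_pair_measurable: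
  shows u_measurable: "u n \<in> Q \<rightarrow>\<^sub>M signs" and v_measurable: "v n \<in> Q \<rightarrow>\<^sub>M signs"
  by (intro innovation_measurable h_measurable component_measurable)+

lemma innovation_event:
  assumes "s \<in> {-1, 1}"
  shows "(\<lambda>z. innovation h z n) -` {s} \<inter> space sign_sequences \<in> sets sign_sequences"
proof (rule measurable_sets)
  show "(\<lambda>z. innovation h z n) \<in> sign_sequences \<rightarrow>\<^sub>M signs"
    by (intro innovation_measurable[where f = "\<lambda>z. z"] h_measurable measurable_component_singleton) simp
qed (use assms in auto)

lemma pull_innovation:
  "pull ((\<lambda>z. innovation h z n) -` {s} \<inter> space sign_sequences) = \<eta> n -` {s} \<inter> space M"
  using measurable_space[OF \<epsilon>_seq_measurable] by (auto simp: innovation_def H_process_def)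

lemma pull_coordinates_before:
  assumes "A \<in> sets (coordinates_before n)"
  shows "pull A \<in> sets (\<epsilon>_before n)"
proof -
  have "\<epsilon>_seq \<in> \<epsilon>_before n \<rightarrow>\<^sub>M coordinates_before n"
    using measurable_space[OF \<epsilon>_seq_measurable] \<epsilon>_adapted
    by (intro measurable_into_generated_sigma) auto
  from measurable_sets[OF this assms] show ?thesis by simp
qed

text \<open>
  Conditioning on \<open>\<eta>\<close> leaves events of \<open>\<eta>\<close> fixed, so the noises of the two copies take opposite signs at time
  \<open>n\<close> with the probability that \<open>\<eta> n\<close> takes both signs.
\<close>

lemma AE_u_eq_v: "AE \<omega> in Q. \<forall>n. u n \<omega> = v n \<omega>"
proof -
  have "AE \<omega> in Q. u n \<omega> = v n \<omega>" for n
  proof -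
    let ?A = "\<lambda>s. (\<lambda>z. innovation h z n) -` {s} \<inter> space sign_sequences"
    have null: "AE \<omega> in Q. \<omega> \<notin> ?A s \<times> ?A (- s)" if s: "s \<in> {-1, 1}" for s
    proof -
      have ms: "- s \<in> {-1, 1}" using s by auto
      have C: "\<eta> n -` {s} \<inter> space M \<in> sets \<eta>_field"
        using measurable_sets[OF \<eta>_adapted[of n UNIV], of "{s}"] s by simp
      have CM: "\<eta> n -` {- s} \<inter> space M \<in> sets M"
        using measurable_sets[OF \<eta>_measurable[of n], of "{- s}"] ms by simp
      have "emeasure Q (?A s \<times> ?A (- s)) = (\<integral>\<^sup>+\<omega>\<in>\<eta> n -` {s} \<inter> space M. cond (\<eta> n -` {- s} \<inter> space M) \<omega> \<partial>M)"
        using emeasure_Q[OF innovation_event[OF s] innovation_event[OF ms]] unfolding pull_innovation .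
      also have "\<dots> = emeasure M ((\<eta> n -` {s} \<inter> space M) \<inter> (\<eta> n -` {- s} \<inter> space M))"
        by (rule nn_integral_cond_field[OF C CM])
      also have "(\<eta> n -` {s} \<inter> space M) \<inter> (\<eta> n -` {- s} \<inter> space M) = {}"
        using s by auto
      finally show ?thesis
        using rectangle_Q[OF innovation_event[OF s] innovation_event[OF ms]]
        by (intro AE_not_in) (simp add: null_sets_def)
    qed
    have "AE \<omega> in Q. \<omega> \<notin> ?A 1 \<times> ?A (- 1)" "AE \<omega> in Q. \<omega> \<notin> ?A (- 1) \<times> ?A (- (- 1))"
      by (rule null, simp)+
    then show ?thesis
      using AE_space
    proof eventually_elim
      case (elim \<omega>)
      have "fst \<omega> \<in> space sign_sequences" "snd \<omega> \<in> space sign_sequences"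
        using elim(3) by (auto simp: space_Q)
      moreover have "u n \<omega> = -1 \<or> u n \<omega> = 1" "v n \<omega> = -1 \<or> v n \<omega> = 1"
        using measurable_space[OF u_measurable elim(3), of n] measurable_space[OF v_measurable elim(3), of n]
        by simp_all
      ultimately show ?case
        using elim(1,2) by (auto simp: mem_Times_iff)
    qed
  qed
  then show ?thesis
    by (simp add: AE_all_countable)
qed

text \<open>
  On a rectangle of events of the two pasts this is \<open>nn_integral_cond_fair\<close>; rectangles generate
  the past of the pair.
\<close>

lemma fair_u: "fair_given Q (pair_before n) (u n)"
proof (rule Q.fair_givenI_generator)
  let ?G = "{A \<times> B | A B. A \<in> sets (coordinates_before n) \<and> B \<in> sets (coordinates_before n)}"
  have space: "space (pair_before n) = space Q"
    by (simp add: space_pair_measure space_Q)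
  have G: "?G \<subseteq> sets Q"
    using coordinates_before_subset[of n] by (auto intro!: rectangle_Q)
  show sets: "sets (pair_before n) = sigma_sets (space Q) ?G"
    by (simp add: sets_pair_measure space_Q)
  then show "subalgebra Q (pair_before n)"
    using sets.sigma_sets_subset[OF G] space by (simp add: subalgebra_def)
  show "u n \<in> Q \<rightarrow>\<^sub>M signs" by (rule u_measurable)
  show "Int_stable ?G" by (rule Int_stable_pair_measure_generator)
  show "?G \<subseteq> Pow (space Q)" using G sets.space_closed by blast
  have "space sign_sequences \<in> sets (coordinates_before n)"
    using sets.top[of "coordinates_before n"] by simp
  then show "space Q \<in> ?G"
    unfolding space_Q by blast
  fix D and s :: int assume "D \<in> ?G" and s: "s \<in> {-1, 1}"
  then obtain A B where D: "D = A \<times> B" and A: "A \<in> sets (coordinates_before n)"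
    and B: "B \<in> sets (coordinates_before n)" by blast
  let ?Z = "(\<lambda>z. innovation h z n) -` {s} \<inter> space sign_sequences"
  have A': "A \<in> sets sign_sequences" and B': "B \<in> sets sign_sequences"
    using A B coordinates_before_subset by blast+
  have "D \<inter> u n -` {s} = (A \<inter> ?Z) \<times> B"
    using sets.sets_into_space[OF A'] by (auto simp: D)
  then have "emeasure Q (D \<inter> u n -` {s}) = (\<integral>\<^sup>+\<omega>\<in>pull (A \<inter> ?Z). cond (pull B) \<omega> \<partial>M)"
    using emeasure_Q[OF sets.Int[OF A' innovation_event[OF s]] B'] by simp
  also have "pull (A \<inter> ?Z) = pull A \<inter> \<eta> n -` {s}"
    using pull_innovation[of n s] by blast
  also have "(\<integral>\<^sup>+\<omega>\<in>pull A \<inter> \<eta> n -` {s}. cond (pull B) \<omega> \<partial>M) = (\<integral>\<^sup>+\<omega>\<in>pull A. cond (pull B) \<omega> \<partial>M) / 2"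
    by (rule nn_integral_cond_fair[OF pull_coordinates_before[OF A] pull_coordinates_before[OF B] s])
  also have "\<dots> = emeasure Q D / 2"
    unfolding D emeasure_Q[OF A' B'] ..
  finally show "emeasure Q (D \<inter> u n -` {s}) = emeasure Q D / 2" .
qed

text \<open>
  Almost surely both copies make their step with the common noise \<open>u n\<close>. For each value \<open>\<alpha>\<close> of the
  noise, the event that \<open>f_step h n \<alpha>\<close> leads from the past of the pair into \<open>A\<close> belongs to that past, and so fairness
  of \<open>u n\<close> halves its probability.
\<close>

lemma coupling_step:
  assumes A: "A \<in> sets E2" and D: "D \<in> sets (pair_before n)"
  defines "s \<equiv> \<lambda>\<alpha> \<omega>. (f_step h n \<alpha> (past (fst \<omega>) (n - 1)), f_step h n \<alpha> (past (snd \<omega>) (n - 1)))"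
  shows "Q.prob {\<omega>\<in>D. (past (fst \<omega>) n, past (snd \<omega>) n) \<in> A} =
    (Q.prob {\<omega>\<in>D. s 1 \<omega> \<in> A} + Q.prob {\<omega>\<in>D. s (-1) \<omega> \<in> A}) / 2"
proof -
  let ?w = "\<lambda>\<omega>. (past (fst \<omega>) n, past (snd \<omega>) n)"
  let ?K = "\<lambda>\<alpha>. {\<omega>\<in>D. s \<alpha> \<omega> \<in> A} \<inter> u n -` {\<alpha>}"
  have sub: "sets (pair_before n) \<subseteq> sets Q"
    using fair_u[of n] by (simp add: fair_given_def subalgebra_def)
  have space: "space (pair_before n) = space Q"
    by (simp add: space_pair_measure space_Q)
  have D_space: "D \<subseteq> space Q"
    using sets.sets_into_space[OF D] space by simp
  have p: "(\<lambda>\<omega>. past (fst \<omega>) (n - 1)) \<in> pair_before n \<rightarrow>\<^sub>M E" "(\<lambda>\<omega>. past (snd \<omega>) (n - 1)) \<in> pair_before n \<rightarrow>\<^sub>M E"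
    using measurable_past[of "n - 1" "\<lambda>k \<omega>. fst \<omega> k" "pair_before n"] measurable_past[of "n - 1" "\<lambda>k \<omega>. snd \<omega> k" "pair_before n"]
      measurable_compose[OF measurable_fst coordinates_before_component, of _ n "coordinates_before n"]
      measurable_compose[OF measurable_snd coordinates_before_component, of _ n "coordinates_before n"]
    by simp_all
  have s: "s \<alpha> \<in> pair_before n \<rightarrow>\<^sub>M E2" if "\<alpha> \<in> {-1, 1}" for \<alpha>
    unfolding s_def
    by (intro measurable_Pair measurable_compose[OF p(1)] measurable_compose[OF p(2)] measurable_f_step h_measurable that)
  have Ds: "{\<omega>\<in>D. s \<alpha> \<omega> \<in> A} \<in> sets (pair_before n)" if "\<alpha> \<in> {-1, 1}" for \<alpha>
  proof -
    have "{\<omega>\<in>D. s \<alpha> \<omega> \<in> A} = D \<inter> (s \<alpha> -` A \<inter> space (pair_before n))"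
      using D_space space by auto
    then show ?thesis using sets.Int[OF D measurable_sets[OF s[OF that] A]] by simp
  qed
  have K: "?K \<alpha> \<in> sets Q" if "\<alpha> \<in> {-1, 1}" for \<alpha>
  proof -
    have "?K \<alpha> = {\<omega>\<in>D. s \<alpha> \<omega> \<in> A} \<inter> (u n -` {\<alpha>} \<inter> space Q)"
      using D_space by auto
    moreover have "u n -` {\<alpha>} \<inter> space Q \<in> sets Q"
      using that by (intro measurable_sets[OF u_measurable]) auto
    ultimately show ?thesis using sub Ds[OF that] by auto
  qed
  have "Q.prob {\<omega>\<in>D. ?w \<omega> \<in> A} = Q.prob (?K 1 \<union> ?K (-1))"
  proof (rule Q.finite_measure_eq_AE)
    show "AE \<omega> in Q. \<omega> \<in> {\<omega>\<in>D. ?w \<omega> \<in> A} \<longleftrightarrow> \<omega> \<in> ?K 1 \<union> ?K (-1)"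
      using AE_u_eq_v AE_space
    proof eventually_elim
      case (elim \<omega>)
      have "past (fst \<omega>) n = f_step h n (u n \<omega>) (past (fst \<omega>) (n - 1))"
          "past (snd \<omega>) n = f_step h n (v n \<omega>) (past (snd \<omega>) (n - 1))"
        using elim(2) h_measurable by (auto intro!: past_eq_f_step_innovation simp: space_Q)
      then have "?w \<omega> = s (u n \<omega>) \<omega>"
        using elim(1) by (simp add: s_def)
      moreover have "u n \<omega> = -1 \<or> u n \<omega> = 1"
        using measurable_space[OF u_measurable elim(2), of n] by simp
      ultimately show ?case by auto
    qed
    show "?K 1 \<union> ?K (-1) \<in> sets Q"
      using K[of 1] K[of "-1"] by auto
    have "{\<omega>\<in>D. ?w \<omega> \<in> A} = D \<inter> (?w -` A \<inter> space Q)"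
      using D_space by auto
    moreover have "?w -` A \<inter> space Q \<in> sets Q"
      by (rule measurable_sets[OF measurable_Pair[OF past_measurable] A])
    ultimately show "{\<omega>\<in>D. ?w \<omega> \<in> A} \<in> sets Q"
      using sub D by auto
  qed
  also have "\<dots> = Q.prob (?K 1) + Q.prob (?K (-1))"
    using K[of 1] K[of "-1"] by (intro Q.finite_measure_Union) auto
  finally have "Q.prob {\<omega>\<in>D. ?w \<omega> \<in> A} = Q.prob (?K 1) + Q.prob (?K (-1))" .
  moreover have "Q.prob (?K \<alpha>) = Q.prob {\<omega>\<in>D. s \<alpha> \<omega> \<in> A} / 2" if "\<alpha> \<in> {-1, 1}" for \<alpha>
  proof -
    have "emeasure Q (?K \<alpha>) = emeasure Q {\<omega>\<in>D. s \<alpha> \<omega> \<in> A} / 2"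
      using fair_u[of n] Ds[OF that] that unfolding fair_given_def by blast
    then show ?thesis
      using divide_ennreal[of "Q.prob {\<omega>\<in>D. s \<alpha> \<omega> \<in> A}" 2] by (simp add: Q.emeasure_eq_measure)
  qed
  from this[of 1] this[of "-1"]
  have "Q.prob (?K 1) = Q.prob {\<omega>\<in>D. s 1 \<omega> \<in> A} / 2" "Q.prob (?K (-1)) = Q.prob {\<omega>\<in>D. s (-1) \<omega> \<in> A} / 2"
    by simp_all
  ultimately show ?thesis by (simp only: add_divide_distrib)
qed

text \<open>
  The pair of pasts, as a measure on the type of sample spaces for which diagonality is assumed.
\<close>

definition path_law :: "path measure" where
  "path_law = distr Q (PiM UNIV (\<lambda>_. E2)) (\<lambda>\<omega> n. (past (fst \<omega>) n, past (snd \<omega>) n))"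

lemma path_measurable: "(\<lambda>\<omega> n. (past (fst \<omega>) n, past (snd \<omega>) n)) \<in> Q \<rightarrow>\<^sub>M PiM UNIV (\<lambda>_. E2)"
  by (intro measurable_sequence measurable_Pair past_measurable)

text \<open>
  Events of the chain before \<open>n\<close> pull back to events of the pair of sequences before \<open>n\<close>, where
  \<open>coupling_step\<close> applies.
\<close>

lemma markov_chain_path_law: "markov_chain h path_law (\<lambda>n p. fst (p n)) (\<lambda>n p. snd (p n))"
proof (rule markov_chainI)
  let ?P = path_law and ?\<psi> = "\<lambda>\<omega> n. (past (fst \<omega>) n, past (snd \<omega>) n)"
  have sets_P: "sets ?P = sets (PiM UNIV (\<lambda>_. E2))" by (simp add: path_law_def)
  have comp: "(\<lambda>p. p n) \<in> ?P \<rightarrow>\<^sub>M E2" for n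
    unfolding measurable_cong_sets[OF sets_P refl] by (rule measurable_component_singleton) simp
  show X: "(\<lambda>p. fst (p n)) \<in> ?P \<rightarrow>\<^sub>M E" and Y: "(\<lambda>p. snd (p n)) \<in> ?P \<rightarrow>\<^sub>M E" for n
    by (rule measurable_compose[OF comp measurable_fst], rule measurable_compose[OF comp measurable_snd])
  show "prob_space ?P" unfolding path_law_def by (rule Q.prob_space_distr[OF path_measurable])
  fix n and A C assume A: "A \<in> sets E2"
    and C: "C \<in> sets (generated_sigma ?P E2 (\<lambda>k p. (fst (p k), snd (p k))) {..n - 1})"
  have "subalgebra ?P (generated_sigma ?P E2 (\<lambda>k p. (fst (p k), snd (p k))) {..n - 1})"
    using comp by (intro subalgebra_generated_sigma) simp
  then have CP: "C \<in> sets ?P" using C by (auto simp: subalgebra_def)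
  let ?D = "?\<psi> -` C \<inter> space Q"
  have D: "?D \<in> sets (pair_before n)"
  proof -
    have space: "space (pair_before n) = space Q"
      by (simp add: space_pair_measure space_Q)
    have "?\<psi> \<in> pair_before n \<rightarrow>\<^sub>M generated_sigma ?P E2 (\<lambda>k p. (fst (p k), snd (p k))) {..n - 1}"
    proof (rule measurable_into_generated_sigma)
      show "?\<psi> \<in> space (pair_before n) \<rightarrow> space ?P"
        using measurable_space[OF path_measurable] unfolding space path_law_def by simp
      fix k assume "k \<in> {..n - 1}"
      then show "(\<lambda>\<omega>. (fst (?\<psi> \<omega> k), snd (?\<psi> \<omega> k))) \<in> pair_before n \<rightarrow>\<^sub>M E2"
        using measurable_past[of k "\<lambda>k \<omega>. fst \<omega> k" "pair_before n"] measurable_past[of k "\<lambda>k \<omega>. snd \<omega> k" "pair_before n"]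
          measurable_compose[OF measurable_fst coordinates_before_component, of _ n "coordinates_before n"]
          measurable_compose[OF measurable_snd coordinates_before_component, of _ n "coordinates_before n"]
        by (simp add: measurable_Pair)
    qed
    from measurable_sets[OF this C] show ?thesis unfolding space .
  qed
  have push: "measure ?P {p\<in>C. g p \<in> A} = Q.prob {\<omega>\<in>?D. g (?\<psi> \<omega>) \<in> A}" if g: "g \<in> ?P \<rightarrow>\<^sub>M E2" for g
  proof -
    have "{p\<in>C. g p \<in> A} = C \<inter> (g -` A \<inter> space ?P)" using sets.sets_into_space[OF CP] by auto
    then have "{p\<in>C. g p \<in> A} \<in> sets (PiM UNIV (\<lambda>_. E2))"
      using sets.Int[OF CP measurable_sets[OF g A]] unfolding sets_P by simp
    then have "measure ?P {p\<in>C. g p \<in> A} = Q.prob (?\<psi> -` {p\<in>C. g p \<in> A} \<inter> space Q)"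
      unfolding path_law_def by (rule measure_distr[OF path_measurable])
    also have "?\<psi> -` {p\<in>C. g p \<in> A} \<inter> space Q = {\<omega>\<in>?D. g (?\<psi> \<omega>) \<in> A}"
      by auto
    finally show ?thesis .
  qed
  have f: "(\<lambda>p. (f_step h n \<alpha> (fst (p (n - 1))), f_step h n \<alpha> (snd (p (n - 1))))) \<in> ?P \<rightarrow>\<^sub>M E2"
    if "\<alpha> \<in> {-1, 1}" for \<alpha>
    by (intro measurable_Pair measurable_compose[OF X] measurable_compose[OF Y] measurable_f_step h_measurable that)
  show "measure ?P {p\<in>C. (fst (p n), snd (p n)) \<in> A} =
      (measure ?P {p\<in>C. (f_step h n 1 (fst (p (n - 1))), f_step h n 1 (snd (p (n - 1)))) \<in> A} +
       measure ?P {p\<in>C. (f_step h n (-1) (fst (p (n - 1))), f_step h n (-1) (snd (p (n - 1)))) \<in> A}) / 2"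
    using coupling_step[OF A D] push[OF comp, of n] push[OF f, of 1] push[OF f, of "-1"] by simp
qed (rule h_measurable)

text \<open>
  For an event \<open>B\<close> of \<open>\<epsilon>\<close>, diagonality says that \<open>P(B | \<eta>)\<close> vanishes almost surely outside \<open>B\<close>. Always
  \<open>P(B | \<eta>) \<noteq> 0\<close> almost surely on \<open>B\<close>. So \<open>B\<close> is almost surely the event that \<open>P(B | \<eta>) \<noteq> 0\<close>.
\<close>

lemma F_infinity_eq_if_diagonal:
  assumes diagonal: "AE \<omega> in Q. fst \<omega> = snd \<omega>"
  shows "F_infinity M \<eta> = F_infinity M \<epsilon>"
proof (rule antisym[OF F_infinity_\<eta>_subset], rule completed_sigma_subset)
  fix k and A :: "int set" assume A: "A \<subseteq> {-1, 1}"
  let ?B = "{z\<in>space sign_sequences. z k \<in> A}" and ?B' = "{z\<in>space sign_sequences. z k \<notin> A}"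
  let ?g = "cond (pull ?B)"
  have B: "?B \<in> sets sign_sequences" "?B' \<in> sets sign_sequences" by (rule sets_sign_sequences_component)+
  have pull_B: "pull ?B = \<epsilon> k -` A \<inter> space M" and pull_B': "pull ?B' = space M - \<epsilon> k -` A"
    using measurable_space[OF \<epsilon>_seq_measurable] by auto
  have "emeasure Q (?B' \<times> ?B) = 0"
  proof -
    have "AE \<omega> in Q. \<omega> \<notin> ?B' \<times> ?B"
      using diagonal by eventually_elim auto
    then show ?thesis
      using AE_iff_null_sets[OF rectangle_Q[OF B(2,1)]] by auto
  qed
  then have "(\<integral>\<^sup>+\<omega>\<in>pull ?B'. ?g \<omega> \<partial>M) = 0"
    using emeasure_Q[OF B(2,1)] by simp
  then have "AE \<omega> in M. ?g \<omega> * indicator (pull ?B') \<omega> = 0"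
    using sets_pull[OF B(2)] by (subst (asm) nn_integral_0_iff_AE) auto
  then have ae1: "AE \<omega> in M. \<epsilon> k \<omega> \<notin> A \<longrightarrow> ?g \<omega> = 0"
    using AE_space unfolding pull_B' by eventually_elim (auto simp: indicator_def split: if_splits)
  let ?D = "{\<omega>\<in>space M. ?g \<omega> = 0}"
  have gD: "?D = ?g -` {0} \<inter> space \<eta>_field" by auto
  have D: "?D \<in> sets \<eta>_field"
    unfolding gD by (rule measurable_sets[OF borel_measurable_nn_cond_exp]) simp
  have "emeasure M (?D \<inter> pull ?B) = (\<integral>\<^sup>+\<omega>\<in>?D. ?g \<omega> \<partial>M)"
    by (rule nn_integral_cond_field[OF D sets_pull[OF B(1)], symmetric])
  also have "\<dots> = (\<integral>\<^sup>+\<omega>. 0 \<partial>M)"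
    by (intro nn_integral_cong) (simp split: split_indicator)
  finally have "AE \<omega> in M. \<omega> \<notin> ?D \<inter> pull ?B"
    using D subalgebra_\<eta>[of UNIV] sets_pull[OF B(1)] by (intro AE_not_in) (auto simp: null_sets_def subalgebra_def)
  then have "AE \<omega> in M. \<omega> \<in> \<epsilon> k -` A \<inter> space M \<longleftrightarrow> \<omega> \<in> space M - ?D"
    using ae1 AE_space unfolding pull_B by eventually_elim auto
  moreover have "space M - ?D \<in> sets \<eta>_field"
    using sets.compl_sets[OF D] by simp
  ultimately show "\<epsilon> k -` A \<inter> space M \<in> F_infinity M \<eta>"
    unfolding mem_completed_sigma_iff by (intro conjI bexI) auto
qed

lemma AE_diagonal:
  assumes "all_chains_diagonal TYPE(path) h"
  shows "AE \<omega> in Q. fst \<omega> = snd \<omega>"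
proof -
  have "AE p in path_law. \<forall>n. fst (p n) = snd (p n)"
    using assms markov_chain_path_law unfolding all_chains_diagonal_def by blast
  from AE_distrD[OF path_measurable this[unfolded path_law_def]]
  have "AE \<omega> in Q. \<forall>n. past (fst \<omega>) n = past (snd \<omega>) n" by simp
  then show ?thesis
  proof eventually_elim
    case (elim \<omega>)
    show ?case
    proof
      fix n
      show "fst \<omega> n = snd \<omega> n"
        using fun_cong[OF spec[OF elim, of n], of 0] by simp
    qed
  qed
qed

end

section \<open>The equivalence\<close>

theorem theorem6:
  fixes M :: "'a measure"
    and \<epsilon> :: "int \<Rightarrow> 'a \<Rightarrow> int"
    and h :: "int \<Rightarrow> sign_seq \<Rightarrow> int"
  assumes "prob_space M"
    and "coin_tossing M \<epsilon>"
    and "\<And>n. h n \<in> E \<rightarrow>\<^sub>M signs"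
  defines "H\<epsilon> \<equiv> \<lambda>n \<omega>. H_process h \<epsilon> n \<omega> * \<epsilon> n \<omega>"
  shows "(F_infinity M H\<epsilon> = F_infinity M \<epsilon> \<longleftrightarrow> (\<forall>n. F_at M H\<epsilon> n = F_at M \<epsilon> n)) \<and>
    ((\<forall>n. F_at M H\<epsilon> n = F_at M \<epsilon> n) \<longleftrightarrow> all_chains_diagonal TYPE(path) h) \<and>
    (all_chains_diagonal TYPE(path) h \<longrightarrow> all_chains_diagonal TYPE('b) h)"
proof -
  interpret sign_change M \<epsilon> h
    using assms(1-3) by (intro sign_change.intro sign_change_axioms.intro)
  have levels: "F_infinity M H\<epsilon> = F_infinity M \<epsilon> \<longleftrightarrow> (\<forall>n. F_at M H\<epsilon> n = F_at M \<epsilon> n)"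
    unfolding H\<epsilon>_def using F_at_eq_if_F_infinity_eq F_infinity_eq_if_F_at_eq by blast
  have paths: "all_chains_diagonal TYPE(path) h" if "F_infinity M H\<epsilon> = F_infinity M \<epsilon>"
    unfolding all_chains_diagonal_def using chain_on_diagonal[OF that[unfolded H\<epsilon>_def]] by blast
  have any_space: "all_chains_diagonal TYPE('b) h" if "F_infinity M H\<epsilon> = F_infinity M \<epsilon>"
    unfolding all_chains_diagonal_def using chain_on_diagonal[OF that[unfolded H\<epsilon>_def]] by blast
  have recover: "F_infinity M H\<epsilon> = F_infinity M \<epsilon>" if diagonal: "all_chains_diagonal TYPE(path) h"
  proof -
    obtain Q where Q: "sets Q = sets (sign_sequences \<Otimes>\<^sub>M sign_sequences)" "prob_space Q"
      "\<And>A B. A \<in> sets sign_sequences \<Longrightarrow> B \<in> sets sign_sequences \<Longrightarrow>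
        emeasure Q (A \<times> B) = (\<integral>\<^sup>+\<omega>\<in>pull A. cond (pull B) \<omega> \<partial>M)"
      by (rule conditionally_independent_copies) blast
    interpret relative_coupling M \<epsilon> h Q
      using Q sign_change_axioms by (intro relative_coupling.intro relative_coupling_axioms.intro)
    show ?thesis
      unfolding H\<epsilon>_def by (rule F_infinity_eq_if_diagonal[OF AE_diagonal[OF diagonal]])
  qed
  show ?thesis
    using levels paths any_space recover by blast
qed

end
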